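(* Let $\mathbf p=(p_k)_{k\ge0}$ be a probability mass function on $\{0,1,2,\dots\}$, let $Z\sim\mathbf p$ and assume $\mathbb E[Z]\le1$. Then: (a) There exists a limiting infinite random sin-tree $\mathcal T_\infty(\mathbf p)$ such that $\{\mathcal T_n(\mathbf p):n\ge1\}$ converges in probability in the extended fringe sense to $\mathcal T_\infty(\mathbf p)$. (b) $\mathrm{ht}(\mathcal T_n(\mathbf p))\to\infty$ in probability as $n\to\infty$, where $\mathrm{ht}$ is the height (maximal graph distance of a vertex from the root).
   Context: Discrete model. Let $Z_1,Z_2,\dots$ be i.i.d. with law $\mathbf p$. The random trees $\mathcal T_n=\mathcal T_n(\mathbf p)$, $n\ge1$, are rooted at $v_0$, with edges directed from children to parents. $\mathcal T_1$ has vertices $v_0,v_1$ and a directed edge from $v_1$ to $v_0$. Given $\mathcal T_n$ with vertex set $\{v_0,\dots,v_n\}$, a new vertex $v_{n+1}$ selects a vertex $V_n$ uniformly at random from $\{v_0,\dots,v_n\}$ and attaches (by a directed edge from $v_{n+1}$) to the vertex at distance $\min(Z_{n+1},\mathrm{dist}(v_0,V_n))$ from $V_n$ on the path from $V_n$ to $v_0$. Here $V_n$ and $Z_{n+1}$ are independent of each other and $Z_{n+1}$ is independent of the past. Extended fringe. $\mathbb T$ is the space of finite rooted trees up to root preserving isomorphism, including the empty tree $\emptyset$. For a finite tree $\mathbf t$ with root $\rho$ and a vertex $v$ at distance $h$ from $\rho$, let $(v_0=v,v_1,\dots,v_h=\rho)$ be the path from $v$ to $\rho$. Let $f_0(v,\mathbf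 t)$ be the subtree rooted at $v$ of all vertices whose path from the root passes through $v$, and for $1\le i\le h$ let $f_i(v,\mathbf t)$ be the subtree rooted at $v_i$ of all vertices whose path from the root passes through $v_i$ but not $v_{i-1}$; set $f_i(v,\mathbf t)=\emptyset$ for $i>h$. Put $F_k(v,\mathbf t)=(f_0(v,\mathbf t),\dots,f_k(v,\mathbf t))$. A sin-tree is an element $\boldsymbol\omega=(\mathbf t_0,\mathbf t_1,\dots)\in\mathbb T^\infty$ with $|\mathbf t_i|\ge1$ for all $i$ (where $|\mathbf t|$ is the number of vertices of $\mathbf t$), viewed as a locally finite infinite tree by joining the roots of $\mathbf t_0,\mathbf t_1,\dots$ along an infinite path $0,1,2,\dots$; $F_k(0,\boldsymbol\omega)=(\mathbf t_0,\dots,\mathbf t_k)$. A random sin-tree is a random element of $\mathbb T^\infty$ that is a.s. a sin-tree. A sequence of random finite rooted trees $\mathcal T_n$ (with $|\mathcal T_n|\to\infty$ in probability) converges in probability in the extended fringe sense to a random sin-tree $\mathcal T_\infty$ if for all $k\ge0$ and all nonempty $\mathbf s_0,\dots,\mathbf s_k\in\mathbb T$, $|\mathcal T_n|^{-1}\#\{v\in\mathcal T_n:F_k(v,\mathcal T_n)=(\mathbf s_0,\dots,\mathbf s_k)\}\to\mathbb P(F_k(0,\mathcal T_\infty)=(\mathbf s_0,\dots,\mathbf s_k))$ in probability.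
   Formalization: The law with Z = 1 almost surely is excluded: it has E[Z] = 1, but every new vertex then attaches to the root, so the trees are stars of height 1 and both (a) and (b) fail for it. *)

theory Defs
  imports "HOL-Probability.Probability"
begin

section \<open>Finite rooted trees and their isomorphism classes\<close>

text \<open>
  A concrete finite rooted tree is given by its vertices, its root and, for each non-root vertex,
  the head of its unique outgoing edge (edges point from children to parents). The value of
  \<open>parent\<close> at the root and outside of \<open>verts\<close> is irrelevant. The empty tree is included.
\<close>

datatype ltree = LTree (verts: "nat set") (root: nat) (parent: "nat \<Rightarrow> nat")

definition is_tree :: "ltree \<Rightarrow> bool" where
  "is_tree t \<longleftrightarrow> finite (verts t) \<and>
     (verts t \<noteq> {} \<longrightarrow>
        root t \<in> verts t \<and>
        (\<forall>v\<in>verts t - {root t}. parent t v \<in> verts t) \<and>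
        (\<forall>v\<in>verts t. \<exists>j. (parent t ^^ j) v = root t))"

definition tree_iso :: "ltree \<Rightarrow> ltree \<Rightarrow> bool" where
  "tree_iso t u \<longleftrightarrow> is_tree t \<and> is_tree u \<and>
     (\<exists>f. bij_betw f (verts t) (verts u) \<and>
          (verts t \<noteq> {} \<longrightarrow> f (root t) = root u) \<and>
          (\<forall>v\<in>verts t - {root t}. f (parent t v) = parent u (f v)))"

lemma tree_iso_refl: "is_tree t \<Longrightarrow> tree_iso t t"
  unfolding tree_iso_def by (intro conjI exI[of _ id]) simp_all

lemma tree_iso_sym:
  assumes "tree_iso t u"
  shows "tree_iso u t"
proof -
  obtain f where f: "bij_betw f (verts t) (verts u)"
      "verts t \<noteq> {} \<Longrightarrow> f (root t) = root u"
      "\<And>v. v \<in> verts t - {root t} \<Longrightarrow> f (parent t v) = parent u (f v)"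
    and wf: "is_tree t" "is_tree u"
    using assms unfolding tree_iso_def by blast
  define g where "g = the_inv_into (verts t) f"
  have g: "bij_betw g (verts u) (verts t)"
    unfolding g_def by (rule bij_betw_the_inv_into[OF f(1)])
  have gf: "g (f x) = x" if "x \<in> verts t" for x
    unfolding g_def using f(1) that by (simp add: bij_betw_def the_inv_into_f_f)
  have fg: "f (g y) = y" if "y \<in> verts u" for y
    unfolding g_def using f(1) that by (simp add: f_the_inv_into_f_bij_betw)
  have gv: "g y \<in> verts t" if "y \<in> verts u" for y
    using bij_betwE[OF g] that by blast
  have ne: "verts t \<noteq> {}" if "verts u \<noteq> {}"
    using f(1) that by (auto simp: bij_betw_def)
  have r: "g (root u) = root t" if "verts u \<noteq> {}"
  proof -
    have "root t \<in> verts t" using ne[OF that] wf(1) by (simp add: is_tree_def)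
    from gf[OF this] f(2)[OF ne[OF that]] show ?thesis by (rule back_subst[of "\<lambda>x. g x = root t"])
  qed
  have "g (parent u v) = parent t (g v)" if v: "v \<in> verts u - {root u}" for v
  proof -
    have gvt: "g v \<in> verts t" using gv v by simp
    have nr: "g v \<noteq> root t"
    proof
      assume "g v = root t"
      moreover have "f (root t) = root u" by (rule f(2)) (use gvt in blast)
      ultimately show False using v fg[of v] by simp
    qed
    have eq: "f (parent t (g v)) = parent u v"
      using f(3)[of "g v"] gvt nr fg[of v] v by simp
    have "verts t \<noteq> {}" using gvt by blast
    then have "parent t (g v) \<in> verts t"
      using wf(1) gvt nr unfolding is_tree_def by blast
    from gf[OF this] show ?thesis unfolding eq .
  qed
  then show ?thesis
    unfolding tree_iso_def using wf g r by blast
qed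

lemma tree_iso_trans:
  assumes "tree_iso t u" "tree_iso u w"
  shows "tree_iso t w"
proof -
  obtain f where f: "bij_betw f (verts t) (verts u)"
      "verts t \<noteq> {} \<Longrightarrow> f (root t) = root u"
      "\<And>v. v \<in> verts t - {root t} \<Longrightarrow> f (parent t v) = parent u (f v)"
    and wf: "is_tree t" "is_tree u"
    using assms(1) unfolding tree_iso_def by blast
  obtain g where g: "bij_betw g (verts u) (verts w)"
      "verts u \<noteq> {} \<Longrightarrow> g (root u) = root w"
      "\<And>v. v \<in> verts u - {root u} \<Longrightarrow> g (parent u v) = parent w (g v)"
    and wf': "is_tree w"
    using assms(2) unfolding tree_iso_def by blast
  have b: "bij_betw (g \<circ> f) (verts t) (verts w)"
    using bij_betw_trans[OF f(1) g(1)] .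
  have ne: "verts u \<noteq> {}" if "verts t \<noteq> {}"
    using bij_betwE[OF f(1)] that by blast
  have r: "(g \<circ> f) (root t) = root w" if "verts t \<noteq> {}"
    using f(2)[OF that] g(2)[OF ne[OF that]] by simp
  have "(g \<circ> f) (parent t v) = parent w ((g \<circ> f) v)" if v: "v \<in> verts t - {root t}" for v
  proof -
    have ne: "verts t \<noteq> {}" using v by blast
    then have rt: "root t \<in> verts t" using wf(1) unfolding is_tree_def by blast
    have "f v \<noteq> f (root t)"
      using inj_onD[OF bij_betw_imp_inj_on[OF f(1)], of v "root t"] v rt by blast
    then have "f v \<in> verts u - {root u}"
      using bij_betwE[OF f(1)] v f(2)[OF ne] by simp
    then show ?thesis using f(3)[OF v] g(3) by simp
  qed
  then show ?thesis
    unfolding tree_iso_def using wf wf' b r by blast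
qed

text \<open>The space of finite rooted trees up to root preserving isomorphism.\<close>

quotient_type rtree = ltree / partial: tree_iso
proof (rule part_equivpI)
  show "\<exists>x. tree_iso x x"
    by (rule exI[of _ "LTree {} 0 id"], rule tree_iso_refl) (simp add: is_tree_def)
  show "symp tree_iso" by (rule sympI) (rule tree_iso_sym)
  show "transp tree_iso" by (rule transpI) (rule tree_iso_trans)
qed

lift_definition empty_tree :: rtree is "LTree {} 0 id"
  by (rule tree_iso_refl) (simp add: is_tree_def)

lift_definition tree_size :: "rtree \<Rightarrow> nat" is "\<lambda>t. card (verts t)"
  unfolding tree_iso_def by (blast dest: bij_betw_same_card)


section \<open>Extended fringe\<close>

definition depth :: "ltree \<Rightarrow> nat \<Rightarrow> nat" where
  "depth t v = (LEAST j. (parent t ^^ j) v = root t)"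

definition tree_height :: "ltree \<Rightarrow> nat" where
  "tree_height t = Max (depth t ` verts t)"

text \<open>For \<open>i \<le> depth t v\<close>, the vertex at distance \<open>i\<close> from \<open>v\<close> on the path from \<open>v\<close> to the root.\<close>

definition ancestor :: "ltree \<Rightarrow> nat \<Rightarrow> nat \<Rightarrow> nat" where
  "ancestor t v i = (parent t ^^ i) v"

definition path_to_root :: "ltree \<Rightarrow> nat \<Rightarrow> nat set" where
  "path_to_root t v = ancestor t v ` {..depth t v}"

definition fringe_verts :: "ltree \<Rightarrow> nat \<Rightarrow> nat \<Rightarrow> nat set" where
  "fringe_verts t v i =
     {u \<in> verts t. ancestor t v i \<in> path_to_root t u \<and>
        (i \<noteq> 0 \<longrightarrow> ancestor t v (i - 1) \<notin> path_to_root t u)}"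

definition fringe :: "ltree \<Rightarrow> nat \<Rightarrow> nat \<Rightarrow> rtree" where
  "fringe t v i =
     (if i \<le> depth t v
      then abs_rtree (LTree (fringe_verts t v i) (ancestor t v i) (parent t))
      else empty_tree)"

definition ext_fringe :: "nat \<Rightarrow> nat \<Rightarrow> ltree \<Rightarrow> rtree list" where
  "ext_fringe k v t = map (fringe t v) [0..<Suc k]"


section \<open>Random sin-trees and convergence\<close>

text \<open>
  A random element of the space of sequences of trees enters only through its law, a probability
  measure on the product \<open>\<sigma>\<close>-algebra of the (countable) discrete space of trees.
\<close>

definition is_sin_tree :: "(nat \<Rightarrow> rtree) \<Rightarrow> bool" where
  "is_sin_tree s \<longleftrightarrow> (\<forall>i. tree_size (s i) \<ge> 1)"

definition random_sin_tree :: "(nat \<Rightarrow> rtree) measure \<Rightarrow> bool" where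
  "random_sin_tree \<mu> \<longleftrightarrow> prob_space \<mu> \<and>
     sets \<mu> = sets (\<Pi>\<^sub>M i\<in>UNIV. count_space (UNIV :: rtree set)) \<and>
     (AE s in \<mu>. is_sin_tree s)"

definition converges_in_prob :: "'w measure \<Rightarrow> (nat \<Rightarrow> 'w \<Rightarrow> real) \<Rightarrow> real \<Rightarrow> bool" where
  "converges_in_prob M X c \<longleftrightarrow>
     (\<forall>e>0. (\<lambda>n. measure M {w \<in> space M. \<bar>X n w - c\<bar> > e}) \<longlonglongrightarrow> 0)"

definition diverges_in_prob :: "'w measure \<Rightarrow> (nat \<Rightarrow> 'w \<Rightarrow> nat) \<Rightarrow> bool" where
  "diverges_in_prob M X \<longleftrightarrow>
     (\<forall>K. (\<lambda>n. measure M {w \<in> space M. X n w \<ge> K}) \<longlonglongrightarrow> 1)"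

definition fringe_proportion :: "nat \<Rightarrow> rtree list \<Rightarrow> ltree \<Rightarrow> real" where
  "fringe_proportion k s t =
     real (card {v \<in> verts t. ext_fringe k v t = s}) / real (card (verts t))"

text \<open>Convergence in probability in the extended fringe sense of random trees \<open>X n\<close>, defined on
  the probability space \<open>M\<close>, to a random sin-tree with law \<open>\<mu>\<close>.\<close>

definition converges_ext_fringe ::
    "'w measure \<Rightarrow> (nat \<Rightarrow> 'w \<Rightarrow> ltree) \<Rightarrow> (nat \<Rightarrow> rtree) measure \<Rightarrow> bool" where
  "converges_ext_fringe M X \<mu> \<longleftrightarrow>
     diverges_in_prob M (\<lambda>n w. card (verts (X n w))) \<and>
     (\<forall>k s. length s = Suc k \<and> empty_tree \<notin> set s \<longrightarrow>
        converges_in_prob M (\<lambda>n w. fringe_proportion k s (X n w))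
          (measure \<mu> {x \<in> space \<mu>. map x [0..<Suc k] = s}))"


section \<open>The attachment model\<close>

text \<open>
  The driving randomness is a sequence of independent pairs. Its \<open>n\<close>-th entry is \<open>(V\<^sub>n, Z\<^sub>n\<^sub>+\<^sub>1)\<close>
  with independent components, \<open>V\<^sub>n\<close> uniform on \<open>{0..n}\<close> and \<open>Z\<^sub>n\<^sub>+\<^sub>1\<close> of law \<open>p\<close>. Since the tree with
  vertices \<open>{0..n}\<close> is a function of the entries with index less than \<open>n\<close>, the vertex \<open>V\<^sub>n\<close> is
  uniform given that tree.
\<close>

definition driving :: "nat pmf \<Rightarrow> (nat \<Rightarrow> nat \<times> nat) measure" where
  "driving p = (\<Pi>\<^sub>M n\<in>UNIV. measure_pmf (pair_pmf (pmf_of_set {0..n}) p))"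

text \<open>
  Vertex \<open>i\<close> is the vertex \<open>v\<^sub>i\<close> of the model. The recursion starts from the single vertex \<open>v\<^sub>0\<close>;
  as \<open>V\<^sub>0 = 0\<close> almost surely, its next state is the prescribed tree with the edge from \<open>v\<^sub>1\<close> to
  \<open>v\<^sub>0\<close>, whatever the value of \<open>Z\<^sub>1\<close>.
\<close>

definition attach :: "ltree \<Rightarrow> nat \<Rightarrow> nat \<Rightarrow> ltree" where
  "attach t new target =
     LTree (insert new (verts t)) (root t) ((parent t)(new := target))"

primrec random_tree :: "nat \<Rightarrow> (nat \<Rightarrow> nat \<times> nat) \<Rightarrow> ltree" where
  "random_tree 0 w = LTree {0} 0 (\<lambda>_. 0)"
| "random_tree (Suc n) w =
     (let t = random_tree n w; v = fst (w n); z = snd (w n)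
      in attach t (Suc n) (ancestor t v (min z (depth t v))))"

text \<open>
  For \<open>p = return_pmf 1\<close>, which has mean 1, every new vertex attaches to \<open>v\<^sub>0\<close> (by induction, \<open>V\<^sub>n\<close> is
  either \<open>v\<^sub>0\<close> or a child of \<open>v\<^sub>0\<close>): the trees are stars of height 1 and have no limiting
  sin-tree. This is the only law of mean at most 1 that gives mass 0 to 0, so within that
  range excluding it amounts to requiring \<open>pmf p 0 > 0\<close>.
\<close>

end

theory Submission
  imports Defs "HOL-Real_Asymp.Real_Asymp"
begin

text \<open>
  The idea is to reduce extended fringes to fringe subtrees, whose counts form a triangular system
  of urns, and then to show that the limits of the proportions carry total mass one.

  \<^bold>\<open>Fringe subtrees.\<close> Number the vertices in order of arrival and describe the subtree below a vertex
  \<open>u\<close> by its code, the list of parents of its members after renumbering. A new vertex attaches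
  inside this subtree only if the uniformly chosen vertex lies in it and the jump is not too long,
  so for \<open>u\<close> different from the root the code of \<open>u\<close> evolves autonomously, by appending \<open>j\<close> at rate
  \<open>birth p ps j\<close>. The number of vertices with code \<open>ps @ [j]\<close> therefore loses elements at a rate
  proportional to itself and gains them at a rate proportional to the number of vertices with code
  \<open>ps\<close>, while every new vertex starts with the empty code. By induction on the length, with a second
  moment estimate for a single urn (\<open>chain_urn_limit\<close>), the proportion of vertices with code \<open>ps\<close>
  converges to an explicit number \<open>fringe_freq p ps\<close>, in mean and thus in probability
  (\<open>occurrences_limit\<close>).

  \<^bold>\<open>Extended fringes.\<close> A vertex \<open>v\<close> with a \<open>k\<close>-th ancestor \<open>u\<close> is the same as \<open>u\<close> together with a
  position of depth \<open>k\<close> in the code of \<open>u\<close>, and this marked code determines the extended fringe of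
  \<open>v\<close>. So the number of vertices with a given extended fringe is a finite linear combination of
  counts of codes (\<open>fringe_card_occurrences\<close>), and its proportion converges too.

  \<^bold>\<open>Total mass.\<close> It remains to see that for each \<open>k\<close> the limits sum to one over all extended fringes
  of depth \<open>k\<close>. Let \<open>q k\<close> be this sum, the proportion of vertices for which the subtree of the \<open>k\<close>-th
  ancestor remains of bounded size. The \<open>k\<close>-th ancestor of a new vertex is the \<open>(k - 1 + Z)\<close>-th
  ancestor of the chosen one, whence \<open>q 0 = 1\<close> and \<open>q k = E q (k - 1 + Z)\<close> for \<open>k \<ge> 1\<close>; no mass is
  lost to infinite sizes because the flux through size \<open>l\<close> is at most \<open>l\<close> times a summable sequence
  (\<open>full_mass_Suc\<close>). Thus \<open>q\<close> is a bounded harmonic function of the random walk with steps \<open>Z - 1\<close>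
  stopped at \<open>0\<close>. If \<open>E Z \<le> 1\<close> and the walk is not constant, it reaches \<open>0\<close>, and the maximum
  principle gives \<open>q = 1\<close> (\<open>full_mass_eq_1\<close>).

  \<^bold>\<open>Conclusion.\<close> The limiting laws of the first \<open>k + 1\<close> trees are now probability measures, they are
  consistent (\<open>fringe_law_consistent\<close>), and their projective limit is the law of the sin-tree. Some
  extended fringe of depth \<open>k\<close> has a positive limiting proportion, so it occurs with probability
  tending to one, which makes the height exceed any \<open>k\<close>.
\<close>

section \<open>Recursive trees as lists of parents\<close>

text \<open>
  A tree whose vertices are numbered in order of arrival is determined by the list of parents of
  \<open>1, 2, \<dots>\<close>. Giving the root and all numbers beyond the list the parent \<open>0\<close> has two effects:
  walking up from any vertex stays at the root once it is reached, so that the truncation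
  \<open>min z (depth v)\<close> of the attachment rule disappears, and the value agrees with the initial
  parent function of the model, so that codes reproduce the random trees on the nose.
\<close>

definition par :: "nat list \<Rightarrow> nat \<Rightarrow> nat" where
  "par ps x = (if 0 < x \<and> x \<le> length ps then ps ! (x - 1) else 0)"

definition ctree :: "nat list \<Rightarrow> ltree" where
  "ctree ps = LTree {..length ps} 0 (par ps)"

definition rec_code :: "nat list \<Rightarrow> bool" where
  "rec_code ps \<longleftrightarrow> (\<forall>j<length ps. ps ! j \<le> j)"

definition level :: "nat list \<Rightarrow> nat \<Rightarrow> nat" where
  "level ps x = (LEAST j. (par ps ^^ j) x = 0)"

lemma ctree_simps [simp]:
  "verts (ctree ps) = {..length ps}" "root (ctree ps) = 0" "parent (ctree ps) = par ps"
  by (auto simp: ctree_def)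

lemma depth_ctree [simp]: "depth (ctree ps) = level ps"
  by (auto simp: depth_def level_def fun_eq_iff)

lemma ancestor_ctree [simp]: "ancestor (ctree ps) x i = (par ps ^^ i) x"
  by (simp add: ancestor_def)

lemma par_0 [simp]: "par ps 0 = 0"
  by (simp add: par_def)

lemma par_iter_0 [simp]: "(par ps ^^ i) 0 = 0"
  by (induction i) auto

lemma rec_code_Nil [simp]: "rec_code []"
  by (simp add: rec_code_def)

lemma rec_code_snoc [simp]: "rec_code (ps @ [j]) \<longleftrightarrow> rec_code ps \<and> j \<le> length ps"
  by (auto simp: rec_code_def nth_append less_Suc_eq)

lemma par_less: "rec_code ps \<Longrightarrow> 0 < x \<Longrightarrow> par ps x < x"
  by (auto simp: par_def rec_code_def) (metis Suc_le_lessD diff_Suc_less le_imp_less_Suc Suc_pred less_Suc_eq_le)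

lemma par_le: "rec_code ps \<Longrightarrow> par ps x \<le> x"
  using par_less[of ps x] by (cases x) auto

lemma par_iter_le: "rec_code ps \<Longrightarrow> (par ps ^^ i) x \<le> x"
  by (induction i) (auto intro: order_trans[OF par_le])

lemma par_iter_le_diff: "rec_code ps \<Longrightarrow> (par ps ^^ i) x \<le> x - i"
proof (induction i)
  case (Suc i)
  show ?case
    using par_less[OF Suc.prems, of "(par ps ^^ i) x"] Suc by (cases "(par ps ^^ i) x = 0") auto
qed auto

lemma par_iter_eq_0_iff:
  assumes "rec_code ps"
  shows "(par ps ^^ i) x = 0 \<longleftrightarrow> level ps x \<le> i"
proof
  assume "level ps x \<le> i"
  have "(par ps ^^ level ps x) x = 0"
    unfolding level_def by (rule LeastI[of _ x]) (use par_iter_le_diff[OF assms, of x x] in simp)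
  moreover have "(par ps ^^ i) x = (par ps ^^ (i - level ps x)) ((par ps ^^ level ps x) x)"
    using \<open>level ps x \<le> i\<close> by (simp flip: funpow_add[THEN fun_cong, unfolded comp_def])
  ultimately show "(par ps ^^ i) x = 0" by simp
qed (auto simp: level_def intro: Least_le)

lemma level_par_iter: "rec_code ps \<Longrightarrow> level ps ((par ps ^^ i) x) = level ps x - i"
proof -
  assume r: "rec_code ps"
  have "level ps ((par ps ^^ i) x) \<le> j \<longleftrightarrow> level ps x - i \<le> j" for j
    using par_iter_eq_0_iff[OF r, of j "(par ps ^^ i) x"] par_iter_eq_0_iff[OF r, of "j + i" x]
    by (simp add: funpow_add) linarith
  then show ?thesis by (metis order_antisym order_refl)
qed

lemma level_0 [simp]: "level ps 0 = 0"
  unfolding level_def by (rule Least_equality) auto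

lemma level_pos: "rec_code ps \<Longrightarrow> 0 < x \<Longrightarrow> level ps x = Suc (level ps (par ps x))"
  using level_par_iter[of ps 1 x] par_iter_eq_0_iff[of ps 0 x] by simp

lemma level_eq_0_iff: "rec_code ps \<Longrightarrow> level ps x = 0 \<longleftrightarrow> x = 0"
  using par_iter_eq_0_iff[of ps 0 x] by simp

lemma par_snoc_old: "x \<le> length ps \<Longrightarrow> par (ps @ [t]) x = par ps x"
  by (auto simp: par_def nth_append)

lemma par_snoc_new [simp]: "par (ps @ [t]) (Suc (length ps)) = t"
  by (auto simp: par_def)

lemma par_iter_snoc_old:
  assumes "rec_code ps" "x \<le> length ps"
  shows "(par (ps @ [t]) ^^ i) x = (par ps ^^ i) x"
proof (induction i)
  case (Suc i)
  then show ?case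
    using par_snoc_old[of "(par ps ^^ i) x" ps t] par_iter_le[OF assms(1), of i x] assms(2) by simp
qed auto

lemma level_snoc_old: "rec_code ps \<Longrightarrow> x \<le> length ps \<Longrightarrow> level (ps @ [t]) x = level ps x"
  by (simp add: level_def par_iter_snoc_old)

lemma level_snoc_new:
  "rec_code ps \<Longrightarrow> t \<le> length ps \<Longrightarrow> level (ps @ [t]) (Suc (length ps)) = Suc (level ps t)"
  by (subst level_pos) (auto simp: level_snoc_old)

section \<open>The code of the subtree below a vertex\<close>

definition is_desc :: "nat list \<Rightarrow> nat \<Rightarrow> nat \<Rightarrow> bool" where
  "is_desc T u x \<longleftrightarrow> (\<exists>i. (par T ^^ i) x = u)"

definition progeny :: "nat list \<Rightarrow> nat \<Rightarrow> nat list" where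
  "progeny T u = filter (is_desc T u) [0..<Suc (length T)]"

text \<open>
  Position of the first occurrence; for an entry that does not occur it is the length of the list.
\<close>

definition index_in :: "nat list \<Rightarrow> nat \<Rightarrow> nat" where
  "index_in xs x = length (takeWhile (\<lambda>y. y \<noteq> x) xs)"

text \<open>
  The subtree below \<open>u\<close>, again written as a list of parents, after renumbering its vertices in
  order of arrival. Keeping the order of arrival is what makes the dynamics simple: a vertex that
  joins the subtree appends one entry, so a code has only one possible predecessor.
\<close>

definition subcode :: "nat list \<Rightarrow> nat \<Rightarrow> nat list" where
  "subcode T u = map (\<lambda>x. index_in (progeny T u) (par T x)) (tl (progeny T u))"

lemma nth_index_in: "x \<in> set xs \<Longrightarrow> xs ! index_in xs x = x"
  unfolding index_in_def by (induction xs) auto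

lemma index_in_less: "x \<in> set xs \<Longrightarrow> index_in xs x < length xs"
  unfolding index_in_def by (induction xs) auto

lemma index_in_nth: "distinct xs \<Longrightarrow> i < length xs \<Longrightarrow> index_in xs (xs ! i) = i"
  by (meson nth_eq_iff_index_eq nth_mem nth_index_in index_in_less)

lemma index_in_append: "x \<in> set xs \<Longrightarrow> index_in (xs @ ys) x = index_in xs x"
  unfolding index_in_def by (subst takeWhile_append1) auto

lemma is_desc_refl [simp]: "is_desc T u u"
  unfolding is_desc_def by (rule exI[of _ 0]) simp

lemma is_desc_le: "rec_code T \<Longrightarrow> is_desc T u x \<Longrightarrow> u \<le> x"
  unfolding is_desc_def using par_iter_le by blast

lemma is_desc_par: "x \<noteq> u \<Longrightarrow> is_desc T u x \<longleftrightarrow> is_desc T u (par T x)"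
  unfolding is_desc_def
  by (metis funpow_0 funpow_Suc_right comp_apply not0_implies_Suc)

lemma set_progeny: "set (progeny T u) = {x. x \<le> length T \<and> is_desc T u x}"
  by (auto simp: progeny_def simp del: upt_Suc)

lemma distinct_progeny [simp]: "distinct (progeny T u)"
  by (simp add: progeny_def)

lemma sorted_progeny [simp]: "sorted (progeny T u)"
  unfolding progeny_def by (intro sorted_wrt_filter sorted_upt)

lemma progeny_0: "rec_code T \<Longrightarrow> progeny T 0 = [0..<Suc (length T)]"
  unfolding progeny_def by (rule filter_True) (auto simp: is_desc_def par_iter_eq_0_iff)

lemma progeny_Cons:
  assumes "rec_code T" "u \<le> length T"
  shows "progeny T u = u # tl (progeny T u)"
proof -
  have u: "u \<in> set (progeny T u)" using assms by (simp add: set_progeny)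
  then obtain y ys where y: "progeny T u = y # ys" by (cases "progeny T u") auto
  have "y \<le> u" using u y sorted_progeny[of T u] by auto
  moreover have "u \<le> y" using y set_progeny[of T u] is_desc_le[OF assms(1), of u y] by auto
  ultimately show ?thesis using y by simp
qed

lemma is_desc_snoc_old:
  "rec_code T \<Longrightarrow> x \<le> length T \<Longrightarrow> is_desc (T @ [t]) u x \<longleftrightarrow> is_desc T u x"
  by (simp add: is_desc_def par_iter_snoc_old)

lemma is_desc_snoc_new:
  assumes "rec_code T" "t \<le> length T" "u \<le> length T"
  shows "is_desc (T @ [t]) u (Suc (length T)) \<longleftrightarrow> is_desc T u t"
  using is_desc_par[of "Suc (length T)" u "T @ [t]"] assms by (simp add: is_desc_snoc_old)

text \<open>
  The new vertex lies below \<open>u\<close> exactly when its parent does, and having the largest number it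
  comes last.
\<close>

lemma progeny_snoc:
  assumes "rec_code T" "t \<le> length T" "u \<le> length T"
  shows "progeny (T @ [t]) u = progeny T u @ (if t \<in> set (progeny T u) then [Suc (length T)] else [])"
proof -
  have "filter (is_desc (T @ [t]) u) [0..<Suc (length T)] = filter (is_desc T u) [0..<Suc (length T)]"
    by (rule filter_cong) (use assms in \<open>auto simp: is_desc_snoc_old\<close>)
  moreover have "[0..<Suc (length (T @ [t]))] = [0..<Suc (length T)] @ [Suc (length T)]"
    by simp
  ultimately show ?thesis
    using is_desc_snoc_new[OF assms] assms(2) unfolding progeny_def filter_append by (auto simp: progeny_def)
qed

lemma progeny_snoc_new:
  assumes "rec_code T" "t \<le> length T"
  shows "progeny (T @ [t]) (Suc (length T)) = [Suc (length T)]"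
proof -
  have "filter (is_desc (T @ [t]) (Suc (length T))) [0..<Suc (length T)] = []"
    using is_desc_le[of "T @ [t]" "Suc (length T)"] assms
    by (fastforce simp: filter_empty_conv simp del: upt_Suc)
  moreover have "[0..<Suc (length (T @ [t]))] = [0..<Suc (length T)] @ [Suc (length T)]"
    by simp
  ultimately show ?thesis by (simp only: progeny_def filter_append) simp
qed

lemma length_subcode: "rec_code T \<Longrightarrow> u \<le> length T \<Longrightarrow> length (progeny T u) = Suc (length (subcode T u))"
  using progeny_Cons[of T u] by (metis subcode_def length_Cons length_map)

text \<open>
  Old positions do not move when a vertex joins at the end of the list, so the code can only be
  extended.
\<close>

lemma subcode_snoc:
  assumes "rec_code T" "t \<le> length T" "u \<le> length T"
  shows "subcode (T @ [t]) u = subcode T u @ (if t \<in> set (progeny T u) then [index_in (progeny T u) t] else [])"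
proof -
  define us where "us = progeny T u"
  have us: "us = u # tl us" using progeny_Cons[OF assms(1,3)] us_def by simp
  define r where "r = (if t \<in> set us then [Suc (length T)] else [])"
  have m: "progeny (T @ [t]) u = us @ r"
    using progeny_snoc[OF assms] by (simp add: us_def r_def)
  have t: "tl (us @ r) = tl us @ r" by (subst us, subst (2) us) simp
  have *: "index_in (us @ r) (par (T @ [t]) x) = index_in us (par T x)" if "x \<in> set (tl us)" for x
  proof -
    have "u \<notin> set (tl us)" using distinct_progeny[of T u] us unfolding us_def[symmetric]
      by (metis distinct.simps(2))
    then have "x \<noteq> u" using that by auto
    moreover have "x \<in> set us" using that us by (metis list.set_intros(2))
    then have x: "x \<le> length T" "is_desc T u x" by (auto simp: us_def set_progeny)
    ultimately have "is_desc T u (par T x)" using is_desc_par by blast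
    moreover have "par T x \<le> length T" using par_le[OF assms(1), of x] x by simp
    ultimately show ?thesis
      using x by (simp add: par_snoc_old index_in_append us_def set_progeny)
  qed
  show ?thesis unfolding subcode_def m t us_def[symmetric]
    using * by (auto simp: r_def index_in_append intro!: map_cong)
qed

lemma subcode_snoc_new:
  "rec_code T \<Longrightarrow> t \<le> length T \<Longrightarrow> subcode (T @ [t]) (Suc (length T)) = []"
  by (simp add: subcode_def progeny_snoc_new)

text \<open>
  The code is the renumbered tree: positions in \<open>progeny T u\<close> carry parents to parents.
\<close>

lemma progeny_par_nth:
  assumes "rec_code T" "u \<le> length T" "0 < x" "x \<le> length (subcode T u)"
  shows "par (subcode T u) x < x" "progeny T u ! par (subcode T u) x = par T (progeny T u ! x)"
proof -
  let ?us = "progeny T u"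
  have len: "length ?us = Suc (length (subcode T u))" by (rule length_subcode[OF assms(1,2)])
  define y where "y = ?us ! x"
  have xin: "x < length ?us" using len assms by simp
  then have y: "y \<in> set ?us" by (simp add: y_def)
  have "?us ! 0 = u" by (subst progeny_Cons[OF assms(1,2)]) simp
  then have "y \<noteq> u" using distinct_progeny[of T u] xin assms(3)
    by (metis y_def length_greater_0_conv list.size(3) not_less0 nth_eq_iff_index_eq order_less_imp_not_eq2)
  then have d: "is_desc T u (par T y)" using y is_desc_par by (auto simp: set_progeny)
  have "0 < y" using y \<open>y \<noteq> u\<close> is_desc_le[OF assms(1), of u y] by (auto simp: set_progeny)
  then have lt: "par T y < y" by (rule par_less[OF assms(1)])
  have py: "par T y \<in> set ?us" using y d lt by (auto simp: set_progeny)
  have p: "par (subcode T u) x = index_in ?us (par T y)"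
    using assms xin by (simp add: par_def subcode_def nth_tl y_def)
  show "?us ! par (subcode T u) x = par T (?us ! x)"
    unfolding p using nth_index_in[OF py] by (simp add: y_def)
  then have "?us ! par (subcode T u) x < ?us ! x" using lt y_def by simp
  then show "par (subcode T u) x < x"
    using sorted_nth_mono[OF sorted_progeny[of T u], of x "par (subcode T u) x"] index_in_less[OF py] p
    by (metis linorder_not_less)
qed

lemma rec_code_subcode: "rec_code T \<Longrightarrow> u \<le> length T \<Longrightarrow> rec_code (subcode T u)"
  unfolding rec_code_def
proof safe
  fix j assume a: "\<forall>j<length T. T ! j \<le> j" "u \<le> length T" and j: "j < length (subcode T u)"
  then have "par (subcode T u) (Suc j) < Suc j"
    using progeny_par_nth(1)[of T u "Suc j"] by (simp add: rec_code_def)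
  then show "subcode T u ! j \<le> j" using j by (simp add: par_def)
qed

lemma progeny_nth_0: "rec_code T \<Longrightarrow> u \<le> length T \<Longrightarrow> progeny T u ! 0 = u"
  by (subst progeny_Cons) auto

lemma progeny_nth_le: "rec_code T \<Longrightarrow> u \<le> length T \<Longrightarrow> x \<le> length (subcode T u) \<Longrightarrow> progeny T u ! x \<le> length T"
  using nth_mem[of x "progeny T u"] length_subcode[of T u] by (auto simp: set_progeny)

lemma progeny_nth_eq_iff:
  "rec_code T \<Longrightarrow> u \<le> length T \<Longrightarrow> x \<le> length (subcode T u) \<Longrightarrow> y \<le> length (subcode T u) \<Longrightarrow>
   progeny T u ! x = progeny T u ! y \<longleftrightarrow> x = y"
  by (simp add: nth_eq_iff_index_eq length_subcode)

lemma progeny_par_iter_nth: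
  assumes "rec_code T" "u \<le> length T" "x \<le> length (subcode T u)" "i \<le> level (subcode T u) x"
  shows "(par T ^^ i) (progeny T u ! x) = progeny T u ! (par (subcode T u) ^^ i) x"
  using assms(4)
proof (induction i)
  case (Suc i)
  let ?y = "(par (subcode T u) ^^ i) x"
  have r: "rec_code (subcode T u)" by (rule rec_code_subcode[OF assms(1,2)])
  have "0 < ?y" using par_iter_eq_0_iff[OF r, of i x] Suc by simp
  moreover have "?y \<le> length (subcode T u)" using par_iter_le[OF r, of i x] assms(3) by simp
  ultimately show ?case using Suc progeny_par_nth(2)[OF assms(1,2), of ?y] by simp
qed auto

lemma progeny_par_iter_level:
  assumes "rec_code T" "u \<le> length T" "x \<le> length (subcode T u)"
  shows "(par T ^^ level (subcode T u) x) (progeny T u ! x) = u"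
proof -
  have "(par (subcode T u) ^^ level (subcode T u) x) x = 0"
    using rec_code_subcode[OF assms(1,2)] by (simp add: par_iter_eq_0_iff)
  then show ?thesis using progeny_par_iter_nth[OF assms order_refl] progeny_nth_0[OF assms(1,2)] by simp
qed

text \<open>
  Walking up from a vertex below \<open>u\<close> leads to \<open>u\<close> first and then on to the root.
\<close>

lemma level_progeny_nth:
  assumes "rec_code T" "u \<le> length T" "x \<le> length (subcode T u)"
  shows "level T (progeny T u ! x) = level (subcode T u) x + level T u"
proof (cases "u = 0")
  case False
  then have "level T u \<noteq> 0" using level_eq_0_iff[OF assms(1)] by simp
  then show ?thesis
    using level_par_iter[OF assms(1), of "level (subcode T u) x" "progeny T u ! x"]
      progeny_par_iter_level[OF assms] by simp
next
  case True
  let ?l = "level (subcode T u) x"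
  have "(par T ^^ ?l) (progeny T u ! x) = 0" using progeny_par_iter_level[OF assms] True by simp
  then have 1: "level T (progeny T u ! x) \<le> ?l" using par_iter_eq_0_iff[OF assms(1)] by simp
  define j where "j = level T (progeny T u ! x)"
  have "(par T ^^ j) (progeny T u ! x) = 0" using par_iter_eq_0_iff[OF assms(1)] j_def by simp
  then have "progeny T u ! (par (subcode T u) ^^ j) x = progeny T u ! 0"
    using progeny_par_iter_nth[OF assms, of j] 1 progeny_nth_0[OF assms(1,2)] True j_def by simp
  moreover have "(par (subcode T u) ^^ j) x \<le> length (subcode T u)"
    using par_iter_le[OF rec_code_subcode[OF assms(1,2)], of j x] assms(3) by simp
  ultimately have "(par (subcode T u) ^^ j) x = 0"
    by (subst (asm) progeny_nth_eq_iff[OF assms(1,2)]) auto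
  then have "?l \<le> j" using par_iter_eq_0_iff[OF rec_code_subcode[OF assms(1,2)]] by simp
  then show ?thesis using 1 True j_def by simp
qed

text \<open>
  This decides from the code alone which choices of starting vertex and jump length land at a
  given vertex of the subtree. A jump longer than the distance to \<open>u\<close> leaves the subtree, because
  \<open>u\<close> is not the root of the whole tree.
\<close>

lemma progeny_par_iter_eq_iff:
  assumes "rec_code T" "0 < u" "u \<le> length T" "x \<le> length (subcode T u)" "j \<le> length (subcode T u)"
  shows "(par T ^^ i) (progeny T u ! x) = progeny T u ! j \<longleftrightarrow>
         i \<le> level (subcode T u) x \<and> (par (subcode T u) ^^ i) x = j"
proof (cases "i \<le> level (subcode T u) x")
  case True
  have "(par (subcode T u) ^^ i) x \<le> length (subcode T u)"
    using par_iter_le[OF rec_code_subcode[OF assms(1,3)], of i x] assms(4) by simp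
  then show ?thesis
    using True progeny_par_iter_nth[OF assms(1,3,4) True] progeny_nth_eq_iff[OF assms(1,3)] assms(5) by simp
next
  case False
  let ?l = "level (subcode T u) x"
  have "level T ((par T ^^ i) (progeny T u ! x)) = level T (progeny T u ! x) - i"
    by (rule level_par_iter[OF assms(1)])
  also have "\<dots> < level T u"
    using False level_progeny_nth[OF assms(1,3,4)] level_eq_0_iff[OF assms(1), of u] assms(2) by simp
  also have "\<dots> \<le> level T (progeny T u ! j)"
    using level_progeny_nth[OF assms(1,3,5)] by simp
  finally show ?thesis using False by auto
qed

section \<open>Extended fringes in terms of codes\<close>

lemma is_desc_trans: "is_desc T u v \<Longrightarrow> is_desc T v w \<Longrightarrow> is_desc T u w"
  unfolding is_desc_def by (metis funpow_add comp_apply)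

lemma path_to_root_ctree:
  assumes "rec_code T"
  shows "w \<in> path_to_root (ctree T) v \<longleftrightarrow> is_desc T w v"
proof
  assume "is_desc T w v"
  then obtain i where i: "(par T ^^ i) v = w" by (auto simp: is_desc_def)
  show "w \<in> path_to_root (ctree T) v"
  proof (cases "i \<le> level T v")
    case False
    then have "w = 0" using i par_iter_eq_0_iff[OF assms, of i v] by simp
    then show ?thesis using par_iter_eq_0_iff[OF assms, of "level T v" v]
      by (auto simp: path_to_root_def intro!: image_eqI[of _ _ "level T v"])
  qed (use i in \<open>auto simp: path_to_root_def\<close>)
qed (auto simp: path_to_root_def is_desc_def)

lemma fringe_verts_ctree:
  assumes "rec_code T"
  shows "fringe_verts (ctree T) v i =
    {w. w \<le> length T \<and> is_desc T ((par T ^^ i) v) w \<and>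
        (i \<noteq> 0 \<longrightarrow> \<not> is_desc T ((par T ^^ (i - 1)) v) w)}"
  by (auto simp: fringe_verts_def path_to_root_ctree[OF assms])

lemma finite_fringe_verts: "rec_code T \<Longrightarrow> finite (fringe_verts (ctree T) v i)"
  by (simp add: fringe_verts_ctree)

text \<open>
  As \<open>i\<close> does not exceed the depth, consecutive ancestors up to the \<open>i\<close>-th differ, and the later
  one is not below the earlier one.
\<close>

lemma root_in_fringe:
  assumes T: "rec_code T" and v: "v \<le> length T" and i: "i \<le> level T v"
  shows "(par T ^^ i) v \<in> fringe_verts (ctree T) v i"
proof -
  let ?r = "(par T ^^ i) v"
  have "\<not> is_desc T ((par T ^^ (i - 1)) v) ?r" if "i \<noteq> 0"
  proof
    assume "is_desc T ((par T ^^ (i - 1)) v) ?r"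
    then have "(par T ^^ (i - 1)) v \<le> ?r" by (rule is_desc_le[OF T])
    moreover have "?r = par T ((par T ^^ (i - 1)) v)" using that by (cases i) auto
    moreover have "0 < (par T ^^ (i - 1)) v"
      using par_iter_eq_0_iff[OF T, of "i - 1" v] that i by (cases "(par T ^^ (i - 1)) v") auto
    ultimately show False using par_less[OF T, of "(par T ^^ (i - 1)) v"] by simp
  qed
  then show ?thesis
    using par_iter_le[OF T, of i v] v by (simp add: fringe_verts_ctree[OF T])
qed

lemma is_tree_fringe:
  assumes T: "rec_code T" and v: "v \<le> length T" and i: "i \<le> level T v"
  shows "is_tree (LTree (fringe_verts (ctree T) v i) ((par T ^^ i) v) (par T))"
proof -
  let ?F = "fringe_verts (ctree T) v i" and ?r = "(par T ^^ i) v"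
  have step: "par T w \<in> ?F" if w: "w \<in> ?F" "w \<noteq> ?r" for w
  proof -
    have "is_desc T ?r (par T w)" using w is_desc_par[of w ?r T] by (simp add: fringe_verts_ctree[OF T])
    moreover have "par T w \<le> length T" using w par_le[OF T, of w] by (simp add: fringe_verts_ctree[OF T])
    moreover have "\<not> is_desc T c (par T w)" if "\<not> is_desc T c w" for c
      using that is_desc_par[of w c T] by (metis is_desc_refl)
    ultimately show ?thesis using w by (simp add: fringe_verts_ctree[OF T])
  qed
  show ?thesis
    unfolding is_tree_def ltree.sel
    using finite_fringe_verts[OF T] root_in_fringe[OF T v i] step
    by (auto simp: fringe_verts_ctree[OF T] is_desc_def)
qed

lemma tree_size_abs: "is_tree t \<Longrightarrow> tree_size (abs_rtree t) = card (verts t)"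
  by (rule tree_size.abs_eq) (rule tree_iso_refl)

lemma tree_size_empty [simp]: "tree_size empty_tree = 0"
  by transfer simp

lemma tree_size_fringe:
  assumes "rec_code T" "v \<le> length T"
  shows "tree_size (fringe (ctree T) v i) =
    (if i \<le> level T v then card (fringe_verts (ctree T) v i) else 0)"
  using tree_size_abs[OF is_tree_fringe[OF assms, of i]] by (simp add: fringe_def)

lemma tree_size_fringe_pos:
  assumes "rec_code T" "v \<le> length T" "i \<le> level T v"
  shows "0 < tree_size (fringe (ctree T) v i)"
  using root_in_fringe[OF assms] finite_fringe_verts[OF assms(1)] assms(3)
  by (auto simp: tree_size_fringe[OF assms(1,2)] card_gt_0_iff)

text \<open>
  An extended fringe without empty entries records that the \<open>k\<close>-th ancestor exists.
\<close>

lemma ext_fringe_nonempty_iff: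
  assumes "rec_code T" "v \<le> length T"
  shows "empty_tree \<notin> set (ext_fringe k v (ctree T)) \<longleftrightarrow> k \<le> level T v"
proof
  assume *: "empty_tree \<notin> set (ext_fringe k v (ctree T))"
  show "k \<le> level T v"
  proof (rule ccontr)
    assume "\<not> k \<le> level T v"
    then have "fringe (ctree T) v k = empty_tree" by (simp add: fringe_def)
    then show False using * by (auto simp: ext_fringe_def)
  qed
next
  assume "k \<le> level T v"
  then have "fringe (ctree T) v i \<noteq> empty_tree" if "i \<le> k" for i
    using tree_size_fringe_pos[OF assms, of i] that by (metis less_irrefl order_trans tree_size_empty)
  then show "empty_tree \<notin> set (ext_fringe k v (ctree T))"
    by (auto simp: ext_fringe_def simp del: upt_Suc) (metis less_Suc_eq_le)
qed

lemma is_desc_progeny_nth: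
  assumes T: "rec_code T" and u: "u \<le> length T"
    and x: "x \<le> length (subcode T u)" and a: "a \<le> length (subcode T u)"
  shows "is_desc T (progeny T u ! a) (progeny T u ! x) \<longleftrightarrow> is_desc (subcode T u) a x"
proof
  let ?ps = "subcode T u" and ?us = "progeny T u"
  note r = rec_code_subcode[OF T u]
  have le: "(par ?ps ^^ i) x \<le> length ?ps" for i using par_iter_le[OF r, of i x] x by simp
  {
    assume "is_desc T (?us ! a) (?us ! x)"
    then obtain i where i: "(par T ^^ i) (?us ! x) = ?us ! a" by (auto simp: is_desc_def)
    show "is_desc ?ps a x"
    proof (cases "i \<le> level ?ps x")
      case True
      then have "?us ! ((par ?ps ^^ i) x) = ?us ! a" using i progeny_par_iter_nth[OF T u x] by simp
      then show ?thesis using progeny_nth_eq_iff[OF T u le a] by (auto simp: is_desc_def)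
    next
      case False
      define l where "l = level ?ps x"
      have "(par T ^^ i) (?us ! x) = (par T ^^ (i - l)) ((par T ^^ l) (?us ! x))"
        using False l_def by (simp flip: funpow_add[THEN fun_cong, unfolded comp_def])
      then have "?us ! a \<le> u"
        using i progeny_par_iter_level[OF T u x] l_def par_iter_le[OF T, of "i - l" u] by simp
      moreover have "u \<le> ?us ! a"
        using nth_mem[of a ?us] a length_subcode[OF T u] is_desc_le[OF T, of u "?us ! a"]
        by (simp add: set_progeny)
      ultimately have "?us ! a = ?us ! 0" using progeny_nth_0[OF T u] by simp
      then have "a = 0" using progeny_nth_eq_iff[OF T u a, of 0] by simp
      then show ?thesis using par_iter_eq_0_iff[OF r, of l x] l_def by (auto simp: is_desc_def)
    qed
  }
  {
    assume "is_desc ?ps a x"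
    then have "a \<in> path_to_root (ctree ?ps) x" using path_to_root_ctree[OF r] by simp
    then obtain i where "i \<le> level ?ps x" "(par ?ps ^^ i) x = a" by (auto simp: path_to_root_def)
    then show "is_desc T (?us ! a) (?us ! x)"
      using progeny_par_iter_nth[OF T u x] by (auto simp: is_desc_def)
  }
qed

lemma progeny_closed:
  assumes T: "rec_code T" and u: "u \<le> length T" and a: "a \<le> length (subcode T u)"
    and w: "w \<le> length T" "is_desc T (progeny T u ! a) w"
  shows "\<exists>y\<le>length (subcode T u). w = progeny T u ! y"
proof -
  have "progeny T u ! a \<in> set (progeny T u)" using a length_subcode[OF T u] by simp
  then have "is_desc T u w" using w by (auto simp: set_progeny intro: is_desc_trans)
  then have "w \<in> set (progeny T u)" using w by (simp add: set_progeny)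
  then show ?thesis using length_subcode[OF T u] by (auto simp: in_set_conv_nth less_Suc_eq_le)
qed

text \<open>
  Renumbering by \<open>progeny T u\<close> is an isomorphism between the two trees: everything that the \<open>i\<close>-th
  fringe tree of a vertex sees, with \<open>i\<close> at most its distance from \<open>u\<close>, lies below \<open>u\<close>.
\<close>

lemma fringe_subcode:
  assumes T: "rec_code T" and u: "u \<le> length T" and x: "x \<le> length (subcode T u)"
    and i: "i \<le> level (subcode T u) x"
  shows "fringe (ctree T) (progeny T u ! x) i = fringe (ctree (subcode T u)) x i"
proof -
  let ?ps = "subcode T u" and ?us = "progeny T u"
  note r = rec_code_subcode[OF T u]
  have le: "(par ?ps ^^ j) x \<le> length ?ps" for j using par_iter_le[OF r, of j x] x by simp
  have iT: "i \<le> level T (?us ! x)" using level_progeny_nth[OF T u x] i by simp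
  have xT: "?us ! x \<le> length T" by (rule progeny_nth_le[OF T u x])
  let ?A = "fringe_verts (ctree ?ps) x i" and ?B = "fringe_verts (ctree T) (?us ! x) i"
  have anc: "(par T ^^ j) (?us ! x) = ?us ! ((par ?ps ^^ j) x)" if "j \<le> i" for j
    using progeny_par_iter_nth[OF T u x, of j] that i by simp
  have memB: "?us ! y \<in> ?B \<longleftrightarrow> y \<in> ?A" if y: "y \<le> length ?ps" for y
    using progeny_nth_le[OF T u y] y anc[of i] anc[of "i - 1"]
    by (simp add: fringe_verts_ctree[OF T] fringe_verts_ctree[OF r] is_desc_progeny_nth[OF T u y le])
  have "?B \<subseteq> (!) ?us ` ?A"
  proof
    fix w assume w: "w \<in> ?B"
    then have "w \<le> length T" "is_desc T (?us ! ((par ?ps ^^ i) x)) w"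
      using anc[of i] by (auto simp: fringe_verts_ctree[OF T])
    then obtain y where "y \<le> length ?ps" "w = ?us ! y" using progeny_closed[OF T u le] by blast
    then show "w \<in> (!) ?us ` ?A" using memB w by auto
  qed
  moreover have A: "y \<le> length ?ps" if "y \<in> ?A" for y using that by (simp add: fringe_verts_ctree[OF r])
  ultimately have img: "(!) ?us ` ?A = ?B" using memB by blast
  have bij: "bij_betw ((!) ?us) ?A ?B"
    using img progeny_nth_eq_iff[OF T u] A by (auto simp: bij_betw_def inj_on_def)
  have "?us ! (par ?ps y) = par T (?us ! y)" if "y \<in> ?A" "y \<noteq> (par ?ps ^^ i) x" for y
  proof -
    have "0 < y" using that is_desc_le[OF r, of "(par ?ps ^^ i) x" y] by (auto simp: fringe_verts_ctree[OF r])
    then show ?thesis using progeny_par_nth(2)[OF T u] A that by simp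
  qed
  then have "tree_iso (LTree ?A ((par ?ps ^^ i) x) (par ?ps)) (LTree ?B ((par T ^^ i) (?us ! x)) (par T))"
    unfolding tree_iso_def
    using is_tree_fringe[OF T xT iT] is_tree_fringe[OF r x i] bij anc[of i]
    by (auto intro!: exI[of _ "(!) ?us"])
  then have "abs_rtree (LTree ?A ((par ?ps ^^ i) x) (par ?ps)) =
      abs_rtree (LTree ?B ((par T ^^ i) (?us ! x)) (par T))"
    by (rule Quotient_rel_abs[OF Quotient_rtree])
  then show ?thesis using i iT by (simp add: fringe_def)
qed

lemma ext_fringe_subcode:
  assumes "rec_code T" "u \<le> length T" "x \<le> length (subcode T u)" "level (subcode T u) x = k"
  shows "ext_fringe k (progeny T u ! x) (ctree T) = ext_fringe k x (ctree (subcode T u))"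
  unfolding ext_fringe_def using fringe_subcode[OF assms(1-3)] assms(4)
  by (intro map_cong) auto

text \<open>
  If \<open>x\<close> has depth \<open>k\<close>, its first \<open>k + 1\<close> fringe trees partition the whole tree: those with index
  at most \<open>j\<close> fill up the subtree below the \<open>j\<close>-th ancestor.
\<close>

lemma ext_fringe_size:
  assumes ps: "rec_code ps" and x: "x \<le> length ps" and k: "level ps x = k"
  shows "sum_list (map tree_size (ext_fringe k x (ctree ps))) = Suc (length ps)"
proof -
  define D where "D j = {w. w \<le> length ps \<and> is_desc ps ((par ps ^^ j) x) w}" for j
  have fin: "finite (D j)" for j unfolding D_def by simp
  have mono: "D j \<subseteq> D (Suc j)" for j
  proof
    fix w assume "w \<in> D j"
    moreover have "is_desc ps ((par ps ^^ Suc j) x) ((par ps ^^ j) x)"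
      unfolding is_desc_def by (rule exI[of _ 1]) simp
    ultimately show "w \<in> D (Suc j)" unfolding D_def using is_desc_trans by blast
  qed
  have "(\<Sum>i\<le>j. card (fringe_verts (ctree ps) x i)) = card (D j)" for j
  proof (induction j)
    case 0
    then show ?case by (simp add: D_def fringe_verts_ctree[OF ps])
  next
    case (Suc j)
    have "fringe_verts (ctree ps) x (Suc j) = D (Suc j) - D j"
      by (auto simp: D_def fringe_verts_ctree[OF ps])
    then have "card (fringe_verts (ctree ps) x (Suc j)) = card (D (Suc j)) - card (D j)"
      using card_Diff_subset[OF fin mono] by simp
    then show ?case using Suc card_mono[OF fin mono[of j]] by simp
  qed
  moreover have "D k = {..length ps}"
  proof -
    have eq: "(par ps ^^ k) x = 0" using par_iter_eq_0_iff[OF ps, of k x] k by simp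
    show ?thesis unfolding D_def is_desc_def eq by (auto simp: par_iter_eq_0_iff[OF ps])
  qed
  ultimately have *: "(\<Sum>i\<le>k. card (fringe_verts (ctree ps) x i)) = Suc (length ps)" by simp
  have "sum_list (map tree_size (ext_fringe k x (ctree ps))) =
      (\<Sum>i\<in>set [0..<Suc k]. tree_size (fringe (ctree ps) x i))"
    by (simp add: ext_fringe_def comp_def sum_list_distinct_conv_sum_set del: upt_Suc)
  also have "\<dots> = (\<Sum>i\<le>k. card (fringe_verts (ctree ps) x i))"
    using k by (intro sum.cong) (auto simp: tree_size_fringe[OF ps x])
  finally show ?thesis using * by simp
qed

text \<open>
  The condition on the level makes the \<open>k\<close>-th ancestor the root, so that \<open>s\<close> uses up the whole tree.
\<close>

definition marks :: "nat \<Rightarrow> rtree list \<Rightarrow> nat list \<Rightarrow> nat set" where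
  "marks k s ps = {x. x \<le> length ps \<and> level ps x = k \<and> ext_fringe k x (ctree ps) = s}"

definition codes :: "nat \<Rightarrow> nat list set" where
  "codes l = {ps. length ps = l \<and> rec_code ps}"

text \<open>
  The root \<open>0\<close> is left out. Its subtree is the whole tree, and a jump that is too long stops there
  instead of leaving it, so it obeys a different rule than all other vertices.
\<close>

definition occurrences :: "nat list \<Rightarrow> nat list \<Rightarrow> nat" where
  "occurrences T ps = card {u \<in> {1..length T}. subcode T u = ps}"

lemma finite_marks [simp]: "finite (marks k s ps)"
  by (simp add: marks_def)

lemma finite_codes [simp]: "finite (codes l)"
proof -
  have "codes l \<subseteq> {xs. set xs \<subseteq> {..l} \<and> length xs = l}"
    by (auto simp: codes_def rec_code_def in_set_conv_nth) (meson le_trans less_imp_le)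
  then show ?thesis by (rule finite_subset) (simp add: finite_lists_length_eq)
qed

text \<open>
  Hence a given \<open>s\<close> is only seen in codes of one length, which form a finite set.
\<close>

lemma marks_length: "rec_code ps \<Longrightarrow> x \<in> marks k s ps \<Longrightarrow> sum_list (map tree_size s) = Suc (length ps)"
  using ext_fringe_size by (auto simp: marks_def)

text \<open>
  A vertex \<open>v\<close> with a \<open>k\<close>-th ancestor \<open>u\<close> is the same thing as \<open>u\<close> together with a position of depth
  \<open>k\<close> in the code of \<open>u\<close>. This reduces extended fringes to ordinary fringe subtrees.
\<close>

lemma fringe_card_eq:
  assumes T: "rec_code T" and s: "empty_tree \<notin> set s"
  shows "card {v \<in> verts (ctree T). ext_fringe k v (ctree T) = s} =
    (\<Sum>u\<le>length T. card (marks k s (subcode T u)))"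
proof -
  let ?S = "SIGMA u:{..length T}. marks k s (subcode T u)"
  have "bij_betw (\<lambda>(u, x). progeny T u ! x) ?S {v \<in> verts (ctree T). ext_fringe k v (ctree T) = s}"
  proof (rule bij_betwI')
    fix a b assume "a \<in> ?S" "b \<in> ?S"
    then obtain u x u' x' where [simp]: "a = (u, x)" "b = (u', x')"
      and u: "u \<le> length T" "u' \<le> length T" and x: "x \<in> marks k s (subcode T u)" "x' \<in> marks k s (subcode T u')"
      by auto
    have xl: "x \<le> length (subcode T u)" "x' \<le> length (subcode T u')" "level (subcode T u) x = k" "level (subcode T u') x' = k"
      using x by (auto simp: marks_def)
    show "(case a of (u, x) \<Rightarrow> progeny T u ! x) = (case b of (u, x) \<Rightarrow> progeny T u ! x) \<longleftrightarrow> a = b"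
    proof
      assume "(case a of (u, x) \<Rightarrow> progeny T u ! x) = (case b of (u, x) \<Rightarrow> progeny T u ! x)"
      then have eq: "progeny T u ! x = progeny T u' ! x'" by simp
      have "u = u'" using progeny_par_iter_level[OF T u(1) xl(1)] progeny_par_iter_level[OF T u(2) xl(2)] eq xl by simp
      then show "a = b" using eq progeny_nth_eq_iff[OF T u(1)] xl by simp
    qed simp
  next
    fix a assume "a \<in> ?S"
    then show "(case a of (u, x) \<Rightarrow> progeny T u ! x) \<in> {v \<in> verts (ctree T). ext_fringe k v (ctree T) = s}"
      using progeny_nth_le[OF T] ext_fringe_subcode[OF T] by (auto simp: marks_def)
  next
    fix v assume "v \<in> {v \<in> verts (ctree T). ext_fringe k v (ctree T) = s}"
    then have v: "v \<le> length T" and e: "ext_fringe k v (ctree T) = s" by auto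
    have k: "k \<le> level T v" using ext_fringe_nonempty_iff[OF T v, of k] e s by simp
    define u where "u = (par T ^^ k) v"
    have u: "u \<le> length T" using par_iter_le[OF T, of k v] v u_def by simp
    have "is_desc T u v" unfolding is_desc_def u_def by blast
    then have "v \<in> set (progeny T u)" using v by (simp add: set_progeny)
    then obtain x where x: "x \<le> length (subcode T u)" "v = progeny T u ! x"
      using length_subcode[OF T u] by (auto simp: in_set_conv_nth less_Suc_eq_le)
    have "level T u = level T v - k" unfolding u_def by (rule level_par_iter[OF T])
    then have "level (subcode T u) x = k" using level_progeny_nth[OF T u x(1)] x(2) k by simp
    then have "x \<in> marks k s (subcode T u)" using x e ext_fringe_subcode[OF T u x(1)] by (simp add: marks_def)
    then show "\<exists>a\<in>?S. v = (case a of (u, x) \<Rightarrow> progeny T u ! x)" using x u by force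
  qed
  then have "card {v \<in> verts (ctree T). ext_fringe k v (ctree T) = s} = card ?S"
    by (simp add: bij_betw_same_card)
  then show ?thesis by simp
qed

text \<open>
  Once the tree is larger than \<open>s\<close>, the root does not contribute.
\<close>

lemma fringe_card_occurrences:
  assumes T: "rec_code T" and s: "empty_tree \<notin> set s"
    and l: "l = sum_list (map tree_size s) - 1" "l < length T"
  shows "card {v \<in> verts (ctree T). ext_fringe k v (ctree T) = s} =
    (\<Sum>ps\<in>codes l. card (marks k s ps) * occurrences T ps)"
proof -
  have none: "marks k s (subcode T u) = {}" if "u \<le> length T" "subcode T u \<notin> codes l" for u
    using that marks_length[OF rec_code_subcode[OF T that(1)]] l rec_code_subcode[OF T that(1)]
    by (fastforce simp: codes_def)
  have "length (subcode T 0) = length T"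
    using length_subcode[OF T, of 0] progeny_0[OF T] by simp
  then have "marks k s (subcode T 0) = {}" using none[of 0] l by (simp add: codes_def)
  moreover have "{..length T} = insert 0 {1..length T}" by auto
  ultimately have "card {v \<in> verts (ctree T). ext_fringe k v (ctree T) = s} =
    (\<Sum>u\<in>{1..length T}. card (marks k s (subcode T u)))"
    unfolding fringe_card_eq[OF T s] by simp
  also have "\<dots> = (\<Sum>u\<in>{1..length T}. \<Sum>ps\<in>codes l. if subcode T u = ps then card (marks k s ps) else 0)"
    using none by (intro sum.cong) (auto simp: sum.delta)
  also have "\<dots> = (\<Sum>ps\<in>codes l. \<Sum>u\<in>{1..length T}. if subcode T u = ps then card (marks k s ps) else 0)"
    by (rule sum.swap)
  also have "\<dots> = (\<Sum>ps\<in>codes l. card (marks k s ps) * occurrences T ps)"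
    by (intro sum.cong) (auto simp: occurrences_def sum.If_cases Int_def conj_commute)
  finally show ?thesis .
qed

section \<open>The tree chain and the drift of subtree counts\<close>

text \<open>
  The rate at which a new vertex attaches to position \<open>j\<close> of a subtree with code \<open>ps\<close> not containing
  the root: starting position \<open>x\<close> and jump \<open>z\<close> lead to \<open>j\<close> without leaving the subtree.
\<close>

definition birth :: "nat pmf \<Rightarrow> nat list \<Rightarrow> nat \<Rightarrow> real" where
  "birth p ps j = (\<Sum>x\<le>length ps. measure_pmf.prob p {z. z \<le> level ps x \<and> (par ps ^^ z) x = j})"

definition total_birth :: "nat pmf \<Rightarrow> nat list \<Rightarrow> real" where
  "total_birth p ps = (\<Sum>j\<le>length ps. birth p ps j)"

text \<open>
  The law of the parent of the next vertex.
\<close>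

definition target :: "nat pmf \<Rightarrow> nat list \<Rightarrow> nat pmf" where
  "target p T = pmf_of_set {0..length T} \<bind> (\<lambda>V. map_pmf (\<lambda>z. (par T ^^ z) V) p)"

primrec chain :: "nat pmf \<Rightarrow> nat \<Rightarrow> nat list pmf" where
  "chain p 0 = return_pmf []"
| "chain p (Suc n) = chain p n \<bind> (\<lambda>T. map_pmf (\<lambda>t. T @ [t]) (target p T))"

lemma birth_nonneg: "0 \<le> birth p ps j"
  by (simp add: birth_def sum_nonneg)

lemma total_birth_nonneg: "0 \<le> total_birth p ps"
  by (simp add: total_birth_def sum_nonneg birth_nonneg)

lemma set_target: "rec_code T \<Longrightarrow> set_pmf (target p T) \<subseteq> {..length T}"
  by (auto simp: target_def intro: order_trans[OF par_iter_le])

lemma finite_set_target: "rec_code T \<Longrightarrow> finite (set_pmf (target p T))"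
  by (rule finite_subset[OF set_target]) auto

lemma set_chain: "set_pmf (chain p n) \<subseteq> codes n"
proof (induction n)
  case (Suc n)
  then show ?case using set_target by (fastforce simp: codes_def)
qed (simp add: codes_def)

lemma finite_set_chain: "finite (set_pmf (chain p n))"
  by (rule finite_subset[OF set_chain]) auto

lemma integrable_chain [simp]: "integrable (chain p n) (f :: _ \<Rightarrow> real)"
  by (rule integrable_measure_pmf_finite[OF finite_set_chain])

lemma integrable_target [simp]: "rec_code T \<Longrightarrow> integrable (target p T) (f :: _ \<Rightarrow> real)"
  by (rule integrable_measure_pmf_finite[OF finite_set_target])

lemma chain_expectation_Suc:
  "measure_pmf.expectation (chain p (Suc n)) (f :: _ \<Rightarrow> real) =
   measure_pmf.expectation (chain p n) (\<lambda>T. measure_pmf.expectation (target p T) (\<lambda>t. f (T @ [t])))"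
proof -
  have "measure_pmf.expectation (chain p (Suc n)) f = (\<Sum>T\<in>codes n. pmf (chain p n) T *\<^sub>R
      measure_pmf.expectation (map_pmf (\<lambda>t. T @ [t]) (target p T)) f)"
    unfolding chain.simps
    by (rule pmf_expectation_bind) (use set_chain finite_set_target finite_codes[of n] in \<open>auto simp: codes_def simp del: finite_codes\<close>)
  also have "\<dots> = measure_pmf.expectation (chain p n) (\<lambda>T. measure_pmf.expectation (target p T) (\<lambda>t. f (T @ [t])))"
    by (subst integral_measure_pmf_real[of "codes n"]) (use set_chain in \<open>auto simp: mult.commute\<close>)
  finally show ?thesis .
qed

lemma pmf_target:
  "pmf (target p T) y =
    (\<Sum>V\<in>{0..length T}. measure_pmf.prob p {z. (par T ^^ z) V = y}) / real (Suc (length T))"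
  unfolding target_def by (simp add: pmf_bind integral_pmf_of_set pmf_map vimage_def)

text \<open>
  Only starting vertices below \<open>u\<close> can lead to a vertex below \<open>u\<close>, so the probability depends on
  the code of \<open>u\<close> alone. This is why the counts of codes evolve autonomously.
\<close>

lemma pmf_target_progeny:
  assumes T: "rec_code T" and u: "0 < u" "u \<le> length T" and j: "j \<le> length (subcode T u)"
  shows "pmf (target p T) (progeny T u ! j) = birth p (subcode T u) j / real (Suc (length T))"
proof -
  let ?us = "progeny T u" and ?ps = "subcode T u"
  let ?P = "\<lambda>V. measure_pmf.prob p {z. (par T ^^ z) V = ?us ! j}"
  have len: "length ?us = Suc (length ?ps)" by (rule length_subcode[OF T u(2)])
  have uj: "is_desc T u (?us ! j)" using nth_mem[of j ?us] len j by (simp add: set_progeny)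
  have "(\<Sum>V\<in>{0..length T}. ?P V) = (\<Sum>V\<in>set ?us. ?P V)"
  proof (rule sum.mono_neutral_right)
    show "\<forall>V\<in>{0..length T} - set ?us. ?P V = 0"
    proof
      fix V assume V: "V \<in> {0..length T} - set ?us"
      have "(par T ^^ z) V \<noteq> ?us ! j" for z
      proof
        assume "(par T ^^ z) V = ?us ! j"
        then have "is_desc T (?us ! j) V" by (auto simp: is_desc_def)
        then have "is_desc T u V" using is_desc_trans[OF uj] by simp
        then show False using V by (auto simp: set_progeny)
      qed
      then show "?P V = 0" by simp
    qed
  qed (auto simp: set_progeny)
  also have "\<dots> = (\<Sum>x\<in>{..<length ?us}. ?P (?us ! x))"
    using sum.reindex_bij_betw[OF bij_betw_nth[OF distinct_progeny[of T u] refl refl], of ?P] by simp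
  also have "\<dots> = birth p ?ps j"
    unfolding birth_def len lessThan_Suc_atMost
    by (intro sum.cong) (simp_all add: progeny_par_iter_eq_iff[OF T u _ j])
  finally show ?thesis by (simp add: pmf_target)
qed

lemma prob_target_progeny:
  assumes T: "rec_code T" and u: "0 < u" "u \<le> length T"
  shows "measure_pmf.prob (target p T) (set (progeny T u)) = total_birth p (subcode T u) / real (Suc (length T))"
proof -
  let ?us = "progeny T u"
  have "measure_pmf.prob (target p T) (set ?us) = (\<Sum>t\<in>set ?us. pmf (target p T) t)"
    by (rule measure_measure_pmf_finite) simp
  also have "\<dots> = (\<Sum>x\<in>{..<length ?us}. pmf (target p T) (?us ! x))"
    using sum.reindex_bij_betw[OF bij_betw_nth[OF distinct_progeny[of T u] refl refl], of "pmf (target p T)"] by simp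
  also have "\<dots> = (\<Sum>x\<le>length (subcode T u). birth p (subcode T u) x / real (Suc (length T)))"
    unfolding length_subcode[OF T u(2)] lessThan_Suc_atMost
    by (intro sum.cong) (simp_all add: pmf_target_progeny[OF T u])
  finally show ?thesis by (simp add: total_birth_def sum_divide_distrib)
qed

text \<open>
  Two subtrees that share a vertex are nested, and strictly so if their roots differ. A new vertex
  therefore changes the code of at most one subtree of each size, which bounds the jumps of the
  counts.
\<close>

lemma progeny_length_unique:
  assumes T: "rec_code T" and u: "u \<le> length T" and v: "v \<le> length T"
    and t: "t \<in> set (progeny T u)" "t \<in> set (progeny T v)" and len: "length (subcode T u) = length (subcode T v)"
  shows "u = v"
proof -
  have *: False if "u < v" and v: "v \<le> length T" and t: "t \<in> set (progeny T u)" "t \<in> set (progeny T v)"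
    and len: "length (subcode T u) = length (subcode T v)" for u v
  proof -
    have u: "u \<le> length T" using that by simp
    obtain i j where i: "(par T ^^ i) t = u" and j: "(par T ^^ j) t = v"
      using t by (auto simp: set_progeny is_desc_def)
    have "j < i"
    proof (rule ccontr)
      assume "\<not> j < i"
      then have "(par T ^^ (j - i)) u = v"
        using i j by (metis funpow_add comp_apply le_add_diff_inverse2 linorder_not_less)
      then show False using par_iter_le[OF T, of "j - i" u] \<open>u < v\<close> by simp
    qed
    then have "(par T ^^ (i - j)) v = u"
      using i j by (metis funpow_add comp_apply le_add_diff_inverse2 less_imp_le)
    then have uv: "is_desc T u v" by (auto simp: is_desc_def)
    have "u \<notin> set (progeny T v)" using is_desc_le[OF T, of v u] \<open>u < v\<close> by (auto simp: set_progeny)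
    moreover have "u \<in> set (progeny T u)" using u by (simp add: set_progeny)
    moreover have "set (progeny T v) \<subseteq> set (progeny T u)" using uv is_desc_trans by (auto simp: set_progeny)
    ultimately have "card (set (progeny T v)) < card (set (progeny T u))"
      by (intro psubset_card_mono) auto
    then show False using len length_subcode[OF T u] length_subcode[OF T v] by (simp add: distinct_card)
  qed
  show ?thesis using *[of u v] *[of v u] assms by (metis linorder_neqE_nat)
qed

text \<open>
  The subtrees with code \<open>ps\<close> that are destroyed by attaching a vertex to \<open>t\<close>.
\<close>

definition losses :: "nat list \<Rightarrow> nat list \<Rightarrow> nat \<Rightarrow> nat set" where
  "losses T ps t = {u \<in> {1..length T}. subcode T u = ps \<and> t \<in> set (progeny T u)}"

text \<open>
  The subtrees that turn into \<open>ps\<close> when a vertex is attached to \<open>t\<close>.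
\<close>

definition gains :: "nat list \<Rightarrow> nat list \<Rightarrow> nat \<Rightarrow> nat set" where
  "gains T ps t = {u \<in> {1..length T}. ps \<noteq> [] \<and> subcode T u = butlast ps \<and> t = progeny T u ! last ps}"

lemma gains_progeny:
  assumes "rec_code T" "rec_code ps" "u \<in> gains T ps t"
  shows "last ps < length (progeny T u)" "t \<in> set (progeny T u)"
proof -
  have "ps \<noteq> []" using assms by (simp add: gains_def)
  then have "ps = butlast ps @ [last ps]" by simp
  then have "last ps \<le> length (butlast ps)" using assms(2) by (metis rec_code_snoc)
  moreover have "length (progeny T u) = Suc (length (butlast ps))"
    using length_subcode[OF assms(1), of u] assms(3) by (auto simp: gains_def)
  ultimately show *: "last ps < length (progeny T u)" by simp
  show "t \<in> set (progeny T u)" using assms(3) nth_mem[OF *] by (auto simp: gains_def)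
qed

text \<open>
  The last summand is the new vertex itself, which is a leaf.
\<close>

lemma occurrences_snoc:
  assumes T: "rec_code T" and t: "t \<le> length T" and ps: "rec_code ps"
  shows "real (occurrences (T @ [t]) ps) =
    real (occurrences T ps) - real (card (losses T ps t)) + real (card (gains T ps t)) + (if ps = [] then 1 else 0)"
proof -
  let ?n = "length T"
  let ?O = "{u \<in> {1..?n}. subcode T u = ps}"
  have subcode: "subcode (T @ [t]) u = subcode T u @ (if t \<in> set (progeny T u) then [index_in (progeny T u) t] else [])"
    if "u \<le> ?n" for u by (rule subcode_snoc[OF T t that])
  have "{u \<in> {1..?n}. subcode (T @ [t]) u = ps} = (?O - losses T ps t) \<union> gains T ps t"
  proof (intro set_eqI)
    fix u
    consider "u \<notin> {1..?n}" | "u \<in> {1..?n}" "t \<in> set (progeny T u)" | "u \<in> {1..?n}" "t \<notin> set (progeny T u)" by blast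
    then show "u \<in> {u \<in> {1..?n}. subcode (T @ [t]) u = ps} \<longleftrightarrow> u \<in> (?O - losses T ps t) \<union> gains T ps t"
    proof cases
      case 2
      have "subcode T u @ [index_in (progeny T u) t] = ps \<longleftrightarrow> u \<in> gains T ps t"
      proof
        assume "subcode T u @ [index_in (progeny T u) t] = ps"
        then show "u \<in> gains T ps t" using 2 nth_index_in[OF 2(2)] by (auto simp: gains_def)
      next
        assume u: "u \<in> gains T ps t"
        have "last ps < length (progeny T u)"
          by (rule gains_progeny(1)[OF T ps u])
        then have "index_in (progeny T u) t = last ps" using u index_in_nth[of "progeny T u" "last ps"] by (auto simp: gains_def)
        then show "subcode T u @ [index_in (progeny T u) t] = ps" using u by (auto simp: gains_def)
      qed
      then show ?thesis using 2 subcode[of u] by (auto simp: losses_def)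
    next
      case 3
      then have "u \<notin> gains T ps t" using gains_progeny(2)[OF T ps, of u t] by auto
      then show ?thesis using 3 subcode[of u] by (auto simp: losses_def)
    qed (auto simp: gains_def losses_def)
  qed
  moreover have "(?O - losses T ps t) \<inter> gains T ps t = {}"
  proof -
    have "butlast ps \<noteq> ps" if "ps \<noteq> []" using that by (metis append_butlast_last_id append_self_conv not_Cons_self2)
    then show ?thesis by (auto simp: gains_def)
  qed
  moreover have "finite (gains T ps t)" "finite (losses T ps t)" "losses T ps t \<subseteq> ?O"
    by (auto simp: gains_def losses_def)
  ultimately have "card {u \<in> {1..?n}. subcode (T @ [t]) u = ps} = card ?O - card (losses T ps t) + card (gains T ps t)"
    "card (losses T ps t) \<le> card ?O"
    by (simp_all add: card_Un_disjoint card_Diff_subset card_mono)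
  moreover have "occurrences (T @ [t]) ps = card {u \<in> {1..?n}. subcode (T @ [t]) u = ps} + (if ps = [] then 1 else 0)"
  proof -
    have "{u \<in> {1..length (T @ [t])}. subcode (T @ [t]) u = ps} =
        (if ps = [] then {Suc ?n} else {}) \<union> {u \<in> {1..?n}. subcode (T @ [t]) u = ps}"
      using subcode_snoc_new[OF T t] by (auto simp: le_Suc_eq)
    then show ?thesis unfolding occurrences_def by (auto simp: card_insert_if)
  qed
  ultimately show ?thesis by (simp add: occurrences_def)
qed

lemma card_losses_le: "rec_code T \<Longrightarrow> card (losses T ps t) \<le> 1"
  unfolding One_nat_def
  by (subst card_le_Suc0_iff_eq) (auto simp: losses_def intro: progeny_length_unique)

lemma card_gains_le:
  assumes "rec_code T" "rec_code ps"
  shows "card (gains T ps t) \<le> 1"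
proof -
  have "u = v" if "u \<in> gains T ps t" "v \<in> gains T ps t" for u v
  proof (rule progeny_length_unique[OF assms(1)])
    show "t \<in> set (progeny T u)" "t \<in> set (progeny T v)" using gains_progeny(2)[OF assms] that by auto
  qed (use that in \<open>auto simp: gains_def\<close>)
  then show ?thesis unfolding One_nat_def
    by (subst card_le_Suc0_iff_eq) (auto simp: gains_def)
qed

lemma occurrences_snoc_jump:
  assumes T: "rec_code T" and t: "t \<le> length T" and ps: "rec_code ps"
  shows "\<bar>real (occurrences (T @ [t]) ps) - real (occurrences T ps)\<bar> \<le> 2"
  using occurrences_snoc[OF assms] card_losses_le[OF T, of ps t] card_gains_le[OF T ps, of t] by auto

lemma expected_losses:
  assumes T: "rec_code T"
  shows "measure_pmf.expectation (target p T) (\<lambda>t. real (card (losses T ps t))) =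
    total_birth p ps * real (occurrences T ps) / real (Suc (length T))"
proof -
  let ?O = "{u \<in> {1..length T}. subcode T u = ps}"
  have "real (card (losses T ps t)) = (\<Sum>u\<in>?O. indicator (set (progeny T u)) t)" for t
  proof -
    have "losses T ps t = {u \<in> ?O. t \<in> set (progeny T u)}" by (auto simp: losses_def)
    then show ?thesis by (simp add: indicator_def sum.If_cases Int_def)
  qed
  then have "measure_pmf.expectation (target p T) (\<lambda>t. real (card (losses T ps t))) =
      (\<Sum>u\<in>?O. measure_pmf.prob (target p T) (set (progeny T u)))"
    using T by (simp add: Bochner_Integration.integral_sum)
  also have "\<dots> = (\<Sum>u\<in>?O. total_birth p ps / real (Suc (length T)))"
    by (intro sum.cong) (auto simp: prob_target_progeny[OF T])
  finally show ?thesis by (simp add: occurrences_def)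
qed

lemma expected_gains:
  assumes T: "rec_code T" and ps: "rec_code ps" "ps \<noteq> []"
  shows "measure_pmf.expectation (target p T) (\<lambda>t. real (card (gains T ps t))) =
    birth p (butlast ps) (last ps) * real (occurrences T (butlast ps)) / real (Suc (length T))"
proof -
  let ?O = "{u \<in> {1..length T}. subcode T u = butlast ps}"
  have l: "last ps \<le> length (butlast ps)" using ps by (metis append_butlast_last_id rec_code_snoc)
  have "real (card (gains T ps t)) = (\<Sum>u\<in>?O. indicator {progeny T u ! last ps} t)" for t
  proof -
    have "gains T ps t = {u \<in> ?O. t = progeny T u ! last ps}" using ps by (auto simp: gains_def)
    then show ?thesis by (simp add: indicator_def sum.If_cases Int_def)
  qed
  then have "measure_pmf.expectation (target p T) (\<lambda>t. real (card (gains T ps t))) =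
      (\<Sum>u\<in>?O. measure_pmf.prob (target p T) {progeny T u ! last ps})"
    using T by (simp add: Bochner_Integration.integral_sum)
  also have "\<dots> = (\<Sum>u\<in>?O. birth p (butlast ps) (last ps) / real (Suc (length T)))"
  proof (intro sum.cong refl)
    fix u assume "u \<in> ?O"
    then show "measure_pmf.prob (target p T) {progeny T u ! last ps} = birth p (butlast ps) (last ps) / real (Suc (length T))"
      using pmf_target_progeny[OF T, of u "last ps" p] l by (auto simp: measure_pmf_single)
  qed
  finally show ?thesis by (simp add: occurrences_def)
qed

lemma expected_occurrences_snoc:
  assumes T: "rec_code T" and ps: "rec_code ps"
  shows "measure_pmf.expectation (target p T) (\<lambda>t. real (occurrences (T @ [t]) ps)) =
    real (occurrences T ps) - total_birth p ps * real (occurrences T ps) / real (Suc (length T)) +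
    (if ps = [] then 1
     else birth p (butlast ps) (last ps) * real (occurrences T (butlast ps)) / real (Suc (length T)))"
proof -
  have "measure_pmf.expectation (target p T) (\<lambda>t. real (occurrences (T @ [t]) ps)) =
      measure_pmf.expectation (target p T) (\<lambda>t. real (occurrences T ps) - real (card (losses T ps t)) +
        real (card (gains T ps t)) + (if ps = [] then 1 else 0))"
  proof (intro integral_cong_AE AE_pmfI)
    fix t assume "t \<in> set_pmf (target p T)"
    then show "real (occurrences (T @ [t]) ps) = real (occurrences T ps) - real (card (losses T ps t)) +
        real (card (gains T ps t)) + (if ps = [] then 1 else 0)"
      using set_target[OF T] by (intro occurrences_snoc[OF T _ ps]) auto
  qed auto
  also have "\<dots> = real (occurrences T ps) - measure_pmf.expectation (target p T) (\<lambda>t. real (card (losses T ps t))) +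
      measure_pmf.expectation (target p T) (\<lambda>t. real (card (gains T ps t))) + (if ps = [] then 1 else 0)"
    using T by simp
  also have "\<dots> = real (occurrences T ps) - total_birth p ps * real (occurrences T ps) / real (Suc (length T)) +
    (if ps = [] then 1
     else birth p (butlast ps) (last ps) * real (occurrences T (butlast ps)) / real (Suc (length T)))"
  proof (cases "ps = []")
    case True
    then have "gains T ps = (\<lambda>t. {})" by (auto simp: gains_def)
    then show ?thesis using True by (simp add: expected_losses[OF T])
  qed (simp add: expected_losses[OF T] expected_gains[OF T ps])
  finally show ?thesis .
qed

section \<open>Convergence of subtree frequencies\<close>

text \<open>
  Beyond its initial value, \<open>y n\<close> is at most \<open>n\<close> times \<open>\<Sum>k<n. \<bar>e k\<bar>\<close>, and a sequence tending to \<open>0\<close> has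
  partial sums of order less than \<open>n\<close>.
\<close>

lemma slow_growth_square:
  fixes y e :: "nat \<Rightarrow> real"
  assumes y: "\<And>n. 0 \<le> y n" and step: "\<And>n. y (Suc n) \<le> y n + real (Suc n) * e n" and e: "e \<longlonglongrightarrow> 0"
  shows "(\<lambda>n. y n / (real (Suc n))\<^sup>2) \<longlonglongrightarrow> 0"
proof (rule LIMSEQ_I)
  fix r :: real assume r: "0 < r"
  then obtain N where N: "\<And>n. n \<ge> N \<Longrightarrow> \<bar>e n\<bar> < r / 2"
    using LIMSEQ_D[OF e, of "r / 2"] by auto
  \<comment> \<open>Beyond \<open>N\<close> every step adds at most \<open>r / 2 * (n + 1)\<close>, less than the increment of \<open>r / 2 * (n + 1)\<^sup>2\<close>.\<close>
  have b: "y n \<le> y N + r / 2 * (real (Suc n))\<^sup>2" if "n \<ge> N" for n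
    using that
  proof (induction n rule: dec_induct)
    case base
    then show ?case using r by simp
  next
    case (step n)
    have "y (Suc n) \<le> y n + real (Suc n) * e n" by (rule assms(2))
    also have "\<dots> \<le> y n + real (Suc n) * (r / 2)" using N[of n] step by (intro add_left_mono mult_left_mono) auto
    also have "\<dots> \<le> y N + r / 2 * ((real (Suc n))\<^sup>2 + real (Suc n))" using step by (simp add: algebra_simps add_divide_distrib)
    also have "\<dots> \<le> y N + r / 2 * (real (Suc (Suc n)))\<^sup>2"
      using r by (intro add_left_mono mult_left_mono) (auto simp: power2_eq_square algebra_simps)
    finally show ?case .
  qed
  have "(\<lambda>n. y N / (real (Suc n))\<^sup>2) \<longlonglongrightarrow> 0" by real_asymp
  then obtain M where M: "\<And>n. n \<ge> M \<Longrightarrow> \<bar>y N / (real (Suc n))\<^sup>2\<bar> < r / 2"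
    using LIMSEQ_D[of "\<lambda>n. y N / (real (Suc n))\<^sup>2" 0 "r / 2"] r by auto
  show "\<exists>no. \<forall>n\<ge>no. norm (y n / (real (Suc n))\<^sup>2 - 0) < r"
  proof (intro exI allI impI)
    fix n assume n: "n \<ge> max N M"
    have "y n / (real (Suc n))\<^sup>2 \<le> (y N + r / 2 * (real (Suc n))\<^sup>2) / (real (Suc n))\<^sup>2"
      using b[of n] n by (intro divide_right_mono) auto
    also have "\<dots> = y N / (real (Suc n))\<^sup>2 + r / 2" by (simp add: add_divide_distrib)
    also have "\<dots> < r"
      using le_less_trans[OF abs_ge_self M[of n]] n by linarith
    finally show "norm (y n / (real (Suc n))\<^sup>2 - 0) < r" using y[of n] by simp
  qed
qed

text \<open>
  A count that loses elements at rate \<open>a X / (n + 1)\<close> and receives them at a rate tending to \<open>\<beta>\<close>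
  balances where \<open>\<beta> = c + a c\<close>. To see it, follow the second moment of \<open>Y = X - c (n + 1)\<close>: the
  drift towards \<open>0\<close> only helps, bounded jumps add a constant per step, and the error of the input
  rate enters multiplied by \<open>Y\<close>, which is at most of order \<open>n\<close>. So the second moment is \<open>o(n\<^sup>2)\<close>.
\<close>

lemma chain_urn_limit:
  fixes X B :: "nat list \<Rightarrow> real"
  assumes a: "0 \<le> a"
    and bd: "\<And>T. rec_code T \<Longrightarrow> 0 \<le> X T \<and> X T \<le> real (Suc (length T))"
    and jump: "\<And>T t. rec_code T \<Longrightarrow> t \<le> length T \<Longrightarrow> \<bar>X (T @ [t]) - X T\<bar> \<le> K"
    and drift: "\<And>T. rec_code T \<Longrightarrow> measure_pmf.expectation (target p T) (\<lambda>t. X (T @ [t])) =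
        X T - a * X T / real (Suc (length T)) + B T"
    and B: "(\<lambda>n. measure_pmf.expectation (chain p n) (\<lambda>T. \<bar>B T - \<beta>\<bar>)) \<longlonglongrightarrow> 0"
  shows "(\<lambda>n. measure_pmf.expectation (chain p n) (\<lambda>T. \<bar>X T / real (Suc n) - \<beta> / (1 + a)\<bar>)) \<longlonglongrightarrow> 0"
proof -
  define c where "c = \<beta> / (1 + a)"
  have "c * (1 + a) = \<beta>" using a by (simp add: c_def)
  then have c: "c + a * c = \<beta>" by (simp add: algebra_simps)
  define Y where "Y T = X T - real (Suc (length T)) * c" for T
  define y where "y n = measure_pmf.expectation (chain p n) (\<lambda>T. (Y T)\<^sup>2)" for n
  define \<eta> where "\<eta> n = measure_pmf.expectation (chain p n) (\<lambda>T. \<bar>B T - \<beta>\<bar>)" for n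
  define e where "e n = 2 * (1 + \<bar>c\<bar>) * \<eta> n + (K + \<bar>c\<bar>)\<^sup>2 / real (Suc n)" for n
  have step: "measure_pmf.expectation (target p T) (\<lambda>t. (Y (T @ [t]))\<^sup>2) \<le>
      (Y T)\<^sup>2 + 2 * (1 + \<bar>c\<bar>) * real (Suc n) * \<bar>B T - \<beta>\<bar> + (K + \<bar>c\<bar>)\<^sup>2"
    if T: "rec_code T" and n: "length T = n" for T n
  proof -
    define D where "D t = X (T @ [t]) - X T - c" for t
    have Y: "Y (T @ [t]) = Y T + D t" for t by (simp add: Y_def D_def algebra_simps)
    let ?E = "measure_pmf.expectation (target p T)"
    have "?E D = - a * X T / real (Suc n) + B T - c"
      unfolding D_def using T drift[OF T] n by simp
    also have "\<dots> = - a * Y T / real (Suc n) + (B T - \<beta>)"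
      using n by (simp add: Y_def c[symmetric] field_simps)
    finally have ED: "?E D = - a * Y T / real (Suc n) + (B T - \<beta>)" .
    have D2: "?E (\<lambda>t. (D t)\<^sup>2) \<le> (K + \<bar>c\<bar>)\<^sup>2"
    proof -
      have "?E (\<lambda>t. (D t)\<^sup>2) \<le> ?E (\<lambda>t. (K + \<bar>c\<bar>)\<^sup>2)"
      proof (intro integral_mono_AE AE_pmfI)
        fix t assume "t \<in> set_pmf (target p T)"
        then have "\<bar>D t\<bar> \<le> K + \<bar>c\<bar>" using jump[OF T, of t] set_target[OF T, of p] by (auto simp: D_def)
        then show "(D t)\<^sup>2 \<le> (K + \<bar>c\<bar>)\<^sup>2" using power_mono[of "\<bar>D t\<bar>" "K + \<bar>c\<bar>" 2] by simp
      qed (use T in auto)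
      then show ?thesis by simp
    qed
    \<comment> \<open>The crude size of \<open>Y\<close> is enough, because the error it multiplies tends to \<open>0\<close> in mean.\<close>
    have "\<bar>Y T\<bar> \<le> (1 + \<bar>c\<bar>) * real (Suc n)"
    proof -
      have "\<bar>Y T\<bar> \<le> \<bar>X T\<bar> + \<bar>real (Suc n) * c\<bar>" unfolding Y_def n by simp
      also have "\<bar>real (Suc n) * c\<bar> = \<bar>c\<bar> * real (Suc n)" by (simp add: abs_mult)
      also have "\<bar>X T\<bar> + \<bar>c\<bar> * real (Suc n) \<le> real (Suc n) + \<bar>c\<bar> * real (Suc n)"
        using bd[OF T] n by (intro add_right_mono) simp
      finally show ?thesis by (simp only: distrib_right mult_1)
    qed
    then have "\<bar>Y T\<bar> * \<bar>B T - \<beta>\<bar> \<le> (1 + \<bar>c\<bar>) * real (Suc n) * \<bar>B T - \<beta>\<bar>"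
      by (rule mult_right_mono) simp
    then have "Y T * (B T - \<beta>) \<le> (1 + \<bar>c\<bar>) * real (Suc n) * \<bar>B T - \<beta>\<bar>"
      by (rule order_trans[rotated]) (simp flip: abs_mult)
    moreover have "Y T * (- a * Y T / real (Suc n)) \<le> 0"
    proof -
      have "Y T * (- a * Y T / real (Suc n)) = - (a * (Y T)\<^sup>2 / real (Suc n))"
        by (simp add: power2_eq_square)
      also have "\<dots> \<le> 0" using a by simp
      finally show ?thesis .
    qed
    ultimately have "2 * Y T * ?E D \<le> 2 * (1 + \<bar>c\<bar>) * real (Suc n) * \<bar>B T - \<beta>\<bar>"
    proof -
      assume 1: "Y T * (B T - \<beta>) \<le> (1 + \<bar>c\<bar>) * real (Suc n) * \<bar>B T - \<beta>\<bar>"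
        and 2: "Y T * (- a * Y T / real (Suc n)) \<le> 0"
      have "2 * Y T * ?E D = 2 * (Y T * (- a * Y T / real (Suc n))) + 2 * (Y T * (B T - \<beta>))"
        unfolding ED by (simp only: distrib_left mult.assoc)
      also have "\<dots> \<le> 2 * 0 + 2 * ((1 + \<bar>c\<bar>) * real (Suc n) * \<bar>B T - \<beta>\<bar>)"
        using 1 2 by (intro add_mono mult_left_mono) auto
      finally show ?thesis by (simp only: mult.assoc mult_zero_right add_0)
    qed
    moreover have "?E (\<lambda>t. (Y (T @ [t]))\<^sup>2) = (Y T)\<^sup>2 + 2 * Y T * ?E D + ?E (\<lambda>t. (D t)\<^sup>2)"
      unfolding Y power2_sum using T by (simp add: mult.assoc)
    ultimately show ?thesis using D2 by simp
  qed
  have "y (Suc n) \<le> y n + real (Suc n) * e n" for n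
  proof -
    have "y (Suc n) \<le> measure_pmf.expectation (chain p n)
        (\<lambda>T. (Y T)\<^sup>2 + 2 * (1 + \<bar>c\<bar>) * real (Suc n) * \<bar>B T - \<beta>\<bar> + (K + \<bar>c\<bar>)\<^sup>2)"
      unfolding y_def chain_expectation_Suc
    proof (intro integral_mono_AE AE_pmfI)
      fix T assume "T \<in> set_pmf (chain p n)"
      then show "measure_pmf.expectation (target p T) (\<lambda>t. (Y (T @ [t]))\<^sup>2) \<le>
          (Y T)\<^sup>2 + 2 * (1 + \<bar>c\<bar>) * real (Suc n) * \<bar>B T - \<beta>\<bar> + (K + \<bar>c\<bar>)\<^sup>2"
        using set_chain[of p n] by (intro step) (auto simp: codes_def)
    qed auto
    also have "\<dots> = y n + real (Suc n) * e n"
      by (simp add: y_def e_def \<eta>_def field_simps)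
    finally show ?thesis .
  qed
  moreover have "e \<longlonglongrightarrow> 0"
  proof -
    have "(\<lambda>n. (K + \<bar>c\<bar>)\<^sup>2 / real (Suc n)) \<longlonglongrightarrow> 0" by real_asymp
    moreover have "(\<lambda>n. 2 * (1 + \<bar>c\<bar>) * \<eta> n) \<longlonglongrightarrow> 0"
      unfolding \<eta>_def by (rule tendsto_mult_right_zero[OF B])
    ultimately show ?thesis using tendsto_add_zero unfolding e_def[abs_def] by blast
  qed
  moreover have "0 \<le> y n" for n unfolding y_def by simp
  ultimately have lim: "(\<lambda>n. y n / (real (Suc n))\<^sup>2) \<longlonglongrightarrow> 0" by (rule slow_growth_square[rotated])
  \<comment> \<open>By the nonnegativity of the variance, the first absolute moment is at most the root of the second.\<close>
  have "measure_pmf.expectation (chain p n) (\<lambda>T. \<bar>X T / real (Suc n) - c\<bar>) \<le> sqrt (y n / (real (Suc n))\<^sup>2)" for n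
  proof (rule real_le_rsqrt)
    let ?Z = "\<lambda>T. \<bar>X T / real (Suc n) - c\<bar>"
    have "0 \<le> measure_pmf.variance (chain p n) ?Z" by simp
    then have "(measure_pmf.expectation (chain p n) ?Z)\<^sup>2 \<le> measure_pmf.expectation (chain p n) (\<lambda>T. (?Z T)\<^sup>2)"
      by (subst (asm) measure_pmf.variance_eq) auto
    also have "\<dots> = measure_pmf.expectation (chain p n) (\<lambda>T. (Y T)\<^sup>2 / (real (Suc n))\<^sup>2)"
    proof (intro integral_cong_AE AE_pmfI)
      fix T assume "T \<in> set_pmf (chain p n)"
      then have "length T = n" using set_chain[of p n] by (auto simp: codes_def)
      then have "X T / real (Suc n) - c = Y T / real (Suc n)" by (simp add: Y_def field_simps)
      then show "(?Z T)\<^sup>2 = (Y T)\<^sup>2 / (real (Suc n))\<^sup>2" by (simp add: power_divide)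
    qed auto
    also have "\<dots> = y n / (real (Suc n))\<^sup>2" by (simp add: y_def)
    finally show "(measure_pmf.expectation (chain p n) ?Z)\<^sup>2 \<le> y n / (real (Suc n))\<^sup>2" .
  qed
  then have "\<forall>\<^sub>F n in sequentially. measure_pmf.expectation (chain p n) (\<lambda>T. \<bar>X T / real (Suc n) - c\<bar>)
      \<le> sqrt (y n / (real (Suc n))\<^sup>2)"
    by (intro always_eventually allI)
  moreover have "(\<lambda>n. sqrt (y n / (real (Suc n))\<^sup>2)) \<longlonglongrightarrow> 0"
    using tendsto_real_sqrt[OF lim] by (simp only: real_sqrt_zero)
  ultimately show ?thesis
    unfolding c_def[symmetric]
    by (rule tendsto_sandwich[OF always_eventually _ tendsto_const, rotated]) simp
qed

text \<open>
  The fixed point of the balance equations: a code of length \<open>n\<close> is fed by its unique predecessor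
  only, and a single vertex is fed by every arrival.
\<close>

function fringe_freq :: "nat pmf \<Rightarrow> nat list \<Rightarrow> real" where
  "fringe_freq p ps =
    (if ps = [] then 1 else birth p (butlast ps) (last ps) * fringe_freq p (butlast ps)) /
    (1 + total_birth p ps)"
  by auto
termination by (relation "Wellfounded.measure (\<lambda>(p, ps). length ps)") auto

declare fringe_freq.simps [simp del]

lemma fringe_freq_Nil: "(1 + total_birth p []) * fringe_freq p [] = 1"
  using total_birth_nonneg[of p "[]"] by (subst fringe_freq.simps) (simp add: field_simps)

lemma fringe_freq_snoc:
  "(1 + total_birth p (ps @ [j])) * fringe_freq p (ps @ [j]) = birth p ps j * fringe_freq p ps"
  using total_birth_nonneg[of p "ps @ [j]"] by (subst fringe_freq.simps) (simp add: field_simps)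

lemma fringe_freq_nonneg: "0 \<le> fringe_freq p ps"
proof (induction ps rule: rev_induct)
  case Nil
  show ?case using total_birth_nonneg[of p "[]"] by (subst fringe_freq.simps) simp
next
  case (snoc j ps)
  then show ?case using total_birth_nonneg[of p "ps @ [j]"] birth_nonneg[of p ps j]
    by (subst fringe_freq.simps) simp
qed

lemma occurrences_le: "occurrences T ps \<le> length T"
proof -
  have "occurrences T ps \<le> card {1..length T}" unfolding occurrences_def by (rule card_mono) auto
  then show ?thesis by simp
qed

text \<open>
  Induction on the length of the code: the count of \<open>ps @ [j]\<close> is an urn whose input rate is
  proportional to the count of \<open>ps\<close>.
\<close>

theorem occurrences_limit:
  assumes "rec_code ps"
  shows "(\<lambda>n. measure_pmf.expectation (chain p n)
    (\<lambda>T. \<bar>real (occurrences T ps) / real (Suc n) - fringe_freq p ps\<bar>)) \<longlonglongrightarrow> 0"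
  using assms
proof (induction ps rule: rev_induct)
  case Nil
  have f: "fringe_freq p [] = 1 / (1 + total_birth p [])" by (subst fringe_freq.simps) simp
  show ?case unfolding f
  proof (rule chain_urn_limit[where K = 2 and B = "\<lambda>T. 1"])
    show "0 \<le> real (occurrences T []) \<and> real (occurrences T []) \<le> real (Suc (length T))" for T
      using occurrences_le[of T "[]"] by simp
    show "\<bar>real (occurrences (T @ [t]) []) - real (occurrences T [])\<bar> \<le> 2" if "rec_code T" "t \<le> length T" for T t
      using that by (intro occurrences_snoc_jump) auto
    show "measure_pmf.expectation (target p T) (\<lambda>t. real (occurrences (T @ [t]) [])) =
        real (occurrences T []) - total_birth p [] * real (occurrences T []) / real (Suc (length T)) + 1"
      if "rec_code T" for T using expected_occurrences_snoc[OF that, of "[]" p] by simp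
  qed (auto simp: total_birth_nonneg)
next
  case (snoc j ps)
  then have ps: "rec_code ps" "rec_code (ps @ [j])" by auto
  have f: "fringe_freq p (ps @ [j]) = birth p ps j * fringe_freq p ps / (1 + total_birth p (ps @ [j]))"
    by (subst fringe_freq.simps) simp
  show ?case unfolding f
  proof (rule chain_urn_limit[where K = 2 and B = "\<lambda>T. birth p ps j * real (occurrences T ps) / real (Suc (length T))"])
    show "0 \<le> real (occurrences T (ps @ [j])) \<and> real (occurrences T (ps @ [j])) \<le> real (Suc (length T))" for T
      using occurrences_le[of T "ps @ [j]"] by simp
    show "\<bar>real (occurrences (T @ [t]) (ps @ [j])) - real (occurrences T (ps @ [j]))\<bar> \<le> 2" if "rec_code T" "t \<le> length T" for T t
      using that ps by (intro occurrences_snoc_jump) auto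
    show "measure_pmf.expectation (target p T) (\<lambda>t. real (occurrences (T @ [t]) (ps @ [j]))) =
        real (occurrences T (ps @ [j])) - total_birth p (ps @ [j]) * real (occurrences T (ps @ [j])) / real (Suc (length T)) +
        birth p ps j * real (occurrences T ps) / real (Suc (length T))"
      if "rec_code T" for T using expected_occurrences_snoc[OF that ps(2), of p] by simp
    have "measure_pmf.expectation (chain p n)
        (\<lambda>T. \<bar>birth p ps j * real (occurrences T ps) / real (Suc (length T)) - birth p ps j * fringe_freq p ps\<bar>) =
      birth p ps j * measure_pmf.expectation (chain p n) (\<lambda>T. \<bar>real (occurrences T ps) / real (Suc n) - fringe_freq p ps\<bar>)" for n
      unfolding integral_mult_right_zero[symmetric]
    proof (intro integral_cong_AE AE_pmfI)
      fix T assume "T \<in> set_pmf (chain p n)"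
      then have "length T = n" using set_chain[of p n] by (auto simp: codes_def)
      then have "birth p ps j * real (occurrences T ps) / real (Suc (length T)) - birth p ps j * fringe_freq p ps =
          birth p ps j * (real (occurrences T ps) / real (Suc n) - fringe_freq p ps)" by (simp add: algebra_simps)
      then show "\<bar>birth p ps j * real (occurrences T ps) / real (Suc (length T)) - birth p ps j * fringe_freq p ps\<bar> =
          birth p ps j * \<bar>real (occurrences T ps) / real (Suc n) - fringe_freq p ps\<bar>"
        by (simp only: abs_mult abs_of_nonneg[OF birth_nonneg])
    qed auto
    then show "(\<lambda>n. measure_pmf.expectation (chain p n)
        (\<lambda>T. \<bar>birth p ps j * real (occurrences T ps) / real (Suc (length T)) - birth p ps j * fringe_freq p ps\<bar>)) \<longlonglongrightarrow> 0"
      using tendsto_mult_right_zero[OF snoc.IH[OF ps(1)]] by simp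
  qed (auto simp: total_birth_nonneg)
qed

section \<open>No mass is lost in the limit\<close>

lemma sum_codes_Suc:
  "(\<Sum>ps\<in>codes (Suc l). f ps) = (\<Sum>ps\<in>codes l. \<Sum>j\<le>l. f (ps @ [j]))"
proof -
  have "bij_betw (\<lambda>(ps, j). ps @ [j]) (codes l \<times> {..l}) (codes (Suc l))"
  proof (rule bij_betwI[where g = "\<lambda>ps. (butlast ps, last ps)"])
    show "(\<lambda>ps. (butlast ps, last ps)) \<in> codes (Suc l) \<rightarrow> codes l \<times> {..l}"
    proof
      fix ps assume ps: "ps \<in> codes (Suc l)"
      then have "ps = butlast ps @ [last ps]" by (auto simp: codes_def intro!: append_butlast_last_id[symmetric])
      then have "rec_code (butlast ps @ [last ps])" using ps by (simp add: codes_def)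
      then show "(butlast ps, last ps) \<in> codes l \<times> {..l}" using ps by (auto simp: codes_def simp del: append_butlast_last_id)
    qed
    show "(case (butlast ps, last ps) of (ps, j) \<Rightarrow> ps @ [j]) = ps" if "ps \<in> codes (Suc l)" for ps
      using that by (auto simp: codes_def intro!: append_butlast_last_id)
  qed (auto simp: codes_def)
  from sum.reindex_bij_betw[OF this, of f]
  have "(\<Sum>ps\<in>codes (Suc l). f ps) = (\<Sum>(ps, j)\<in>codes l \<times> {..l}. f (ps @ [j]))"
    by (simp add: case_prod_beta)
  then show ?thesis by (simp add: sum.cartesian_product)
qed

lemma codes_0 [simp]: "codes 0 = {[]}"
  by (auto simp: codes_def)

definition layer :: "nat \<Rightarrow> nat list \<Rightarrow> nat" where
  "layer k ps = card {x. x \<le> length ps \<and> level ps x = k}"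

text \<open>
  The limiting proportion of vertices whose \<open>k\<close>-th ancestor exists and has exactly \<open>l\<close> proper
  descendants.
\<close>

definition layer_mass :: "nat pmf \<Rightarrow> nat \<Rightarrow> nat \<Rightarrow> real" where
  "layer_mass p k l = (\<Sum>ps\<in>codes l. real (layer k ps) * fringe_freq p ps)"

text \<open>
  The limiting rate at which the vertices counted by \<open>layer_mass p k l\<close> are carried to \<open>l + 1\<close> by
  the growth of the subtree of their \<open>k\<close>-th ancestor.
\<close>

definition layer_flux :: "nat pmf \<Rightarrow> nat \<Rightarrow> nat \<Rightarrow> real" where
  "layer_flux p k l = (\<Sum>ps\<in>codes l. real (layer k ps) * total_birth p ps * fringe_freq p ps)"

lemma layer_Nil: "layer k [] = (if k = 0 then 1 else 0)"
proof -
  have "{x. x \<le> length [] \<and> level [] x = k} = (if k = 0 then {0} else {})" by auto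
  then show ?thesis unfolding layer_def by simp
qed

lemma layer_snoc:
  assumes ps: "rec_code ps" and j: "j \<le> length ps"
  shows "layer k (ps @ [j]) = layer k ps + (if k = Suc (level ps j) then 1 else 0)"
proof -
  have "{x. x \<le> length (ps @ [j]) \<and> level (ps @ [j]) x = k} =
      {x. x \<le> length ps \<and> level ps x = k} \<union> (if k = Suc (level ps j) then {Suc (length ps)} else {})"
    by (auto simp: le_Suc_eq level_snoc_old[OF ps] level_snoc_new[OF ps j])
  then show ?thesis unfolding layer_def by (simp add: card_insert_if)
qed

lemma birth_expectation:
  "birth p ps j = measure_pmf.expectation p
     (\<lambda>z. \<Sum>x\<le>length ps. if z \<le> level ps x \<and> (par ps ^^ z) x = j then 1 else 0)"
proof -
  have "measure_pmf.prob p {z. z \<le> level ps x \<and> (par ps ^^ z) x = j} =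
      measure_pmf.expectation p (\<lambda>z. if z \<le> level ps x \<and> (par ps ^^ z) x = j then 1 else 0)" for x
  proof -
    have "(\<lambda>z. if z \<le> level ps x \<and> (par ps ^^ z) x = j then 1 else 0) =
        indicat_real {z. z \<le> level ps x \<and> (par ps ^^ z) x = j}" by (auto simp: indicator_def)
    then show ?thesis by simp
  qed
  then show ?thesis unfolding birth_def
    by (subst Bochner_Integration.integral_sum)
       (auto intro!: measure_pmf.integrable_const_bound[where B = 1])
qed

lemma integrable_pmf_bounded: "(\<And>z. \<bar>f z\<bar> \<le> (B :: real)) \<Longrightarrow> integrable (measure_pmf p) f"
  by (rule measure_pmf.integrable_const_bound[where B = B]) auto

lemma birth_term_bound:
  "\<bar>\<Sum>x\<le>length ps. if P z x then 1 else 0 :: real\<bar> \<le> real (Suc (length ps))"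
proof -
  have "(\<Sum>x\<le>length ps. if P z x then 1 else 0 :: real) \<le> (\<Sum>x\<le>length ps. 1)" by (rule sum_mono) auto
  moreover have "0 \<le> (\<Sum>x\<le>length ps. if P z x then 1 else 0 :: real)" by (rule sum_nonneg) auto
  ultimately show ?thesis by simp
qed

text \<open>
  Integrate over the jump instead of summing over the target.
\<close>

lemma weighted_birth:
  assumes ps: "rec_code ps"
  shows "(\<Sum>j\<le>length ps. w j * birth p ps j) = measure_pmf.expectation p
     (\<lambda>z. \<Sum>x\<le>length ps. if z \<le> level ps x then w ((par ps ^^ z) x) else 0)"
proof -
  have "(\<Sum>j\<le>length ps. w j * birth p ps j) = measure_pmf.expectation p
     (\<lambda>z. \<Sum>j\<le>length ps. w j * (\<Sum>x\<le>length ps. if z \<le> level ps x \<and> (par ps ^^ z) x = j then 1 else 0))"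
    unfolding birth_expectation
    by (subst Bochner_Integration.integral_sum)
       (auto intro!: integrable_mult_right integrable_pmf_bounded birth_term_bound)
  also have "(\<lambda>z. \<Sum>j\<le>length ps. w j * (\<Sum>x\<le>length ps. if z \<le> level ps x \<and> (par ps ^^ z) x = j then 1 else 0)) =
     (\<lambda>z. \<Sum>x\<le>length ps. if z \<le> level ps x then w ((par ps ^^ z) x) else 0)"
  proof
    fix z
    have "(\<Sum>j\<le>length ps. w j * (\<Sum>x\<le>length ps. if z \<le> level ps x \<and> (par ps ^^ z) x = j then 1 else 0)) =
      (\<Sum>x\<le>length ps. \<Sum>j\<le>length ps. if j = (par ps ^^ z) x then (if z \<le> level ps x then w j else 0) else 0)"
      unfolding sum_distrib_left by (subst sum.swap) (auto intro!: sum.cong)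
    also have "\<dots> = (\<Sum>x\<le>length ps. if z \<le> level ps x then w ((par ps ^^ z) x) else 0)"
    proof (intro sum.cong refl)
      fix x assume "x \<in> {..length ps}"
      then have "(par ps ^^ z) x \<in> {..length ps}" using par_iter_le[OF ps, of z x] by simp
      then show "(\<Sum>j\<le>length ps. if j = (par ps ^^ z) x then (if z \<le> level ps x then w j else 0) else 0) =
          (if z \<le> level ps x then w ((par ps ^^ z) x) else 0)" by (simp add: sum.delta)
    qed
    finally show "(\<Sum>j\<le>length ps. w j * (\<Sum>x\<le>length ps. if z \<le> level ps x \<and> (par ps ^^ z) x = j then 1 else 0)) =
      (\<Sum>x\<le>length ps. if z \<le> level ps x then w ((par ps ^^ z) x) else 0)" .
  qed
  finally show ?thesis .
qed

text \<open>
  Each starting position succeeds with probability at most one.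
\<close>

lemma total_birth_le: "rec_code ps \<Longrightarrow> total_birth p ps \<le> real (Suc (length ps))"
proof -
  assume ps: "rec_code ps"
  have "total_birth p ps = measure_pmf.expectation p (\<lambda>z. \<Sum>x\<le>length ps. if z \<le> level ps x then 1 else 0)"
    using weighted_birth[OF ps, of "\<lambda>_. 1" p] by (simp add: total_birth_def)
  also have "\<dots> \<le> measure_pmf.expectation p (\<lambda>z. real (Suc (length ps)))"
    using birth_term_bound[of "\<lambda>z x. z \<le> level ps x" _ ps]
    by (intro integral_mono integrable_pmf_bounded) (auto intro: order_trans[OF abs_ge_self])
  finally show ?thesis by simp
qed

text \<open>
  The walk arrives at depth \<open>k\<close> after a jump of length \<open>z\<close> exactly if it started at depth \<open>k + z\<close>.
\<close>

lemma birth_in_layer: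
  assumes ps: "rec_code ps"
  shows "(\<Sum>j\<le>length ps. (if level ps j = k then 1 else 0) * birth p ps j) =
    measure_pmf.expectation p (\<lambda>z. real (layer (k + z) ps))"
proof -
  have "(\<Sum>x\<le>length ps. if z \<le> level ps x then (if level ps ((par ps ^^ z) x) = k then 1 else 0) else 0 :: real) =
      real (layer (k + z) ps)" for z
  proof -
    have "(\<Sum>x\<le>length ps. if z \<le> level ps x then (if level ps ((par ps ^^ z) x) = k then 1 else 0) else 0 :: real) =
        (\<Sum>x\<in>{..length ps}. if level ps x = k + z then 1 else 0)"
      by (intro sum.cong) (auto simp: level_par_iter[OF ps])
    then show ?thesis by (simp add: layer_def sum.If_cases Int_def)
  qed
  then show ?thesis by (simp add: weighted_birth[OF ps])
qed

lemma layer_le: "layer k ps \<le> Suc (length ps)"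
proof -
  have "layer k ps \<le> card {..length ps}" unfolding layer_def by (intro card_mono) auto
  then show ?thesis by simp
qed

lemma integrable_layer [simp]: "integrable (measure_pmf p) (\<lambda>z. real (layer (f z) ps))"
  by (rule integrable_pmf_bounded[where B = "real (Suc (length ps))"])
     (use layer_le in \<open>simp del: of_nat_Suc\<close>)

lemma layer_mass_nonneg: "0 \<le> layer_mass p k l"
  by (simp add: layer_mass_def sum_nonneg fringe_freq_nonneg)

lemma layer_flux_nonneg: "0 \<le> layer_flux p k l"
  by (simp add: layer_flux_def sum_nonneg fringe_freq_nonneg total_birth_nonneg)

text \<open>
  A subtree grows at a rate of at most its size.
\<close>

lemma layer_flux_le: "layer_flux p k l \<le> real (Suc l) * layer_mass p k l"
  unfolding layer_flux_def layer_mass_def sum_distrib_left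
proof (rule sum_mono)
  fix ps assume ps: "ps \<in> codes l"
  then have "total_birth p ps \<le> real (Suc l)" using total_birth_le[of ps p] by (simp add: codes_def)
  then have "total_birth p ps * (real (layer k ps) * fringe_freq p ps) \<le>
      real (Suc l) * (real (layer k ps) * fringe_freq p ps)"
    by (rule mult_right_mono) (simp add: fringe_freq_nonneg)
  then show "real (layer k ps) * total_birth p ps * fringe_freq p ps \<le>
      real (Suc l) * (real (layer k ps) * fringe_freq p ps)" by (simp only: mult_ac)
qed

lemma layer_balance_0: "layer_mass p k 0 + layer_flux p k 0 = (if k = 0 then 1 else 0)"
  using fringe_freq_Nil[of p] by (simp add: layer_mass_def layer_flux_def layer_Nil algebra_simps)

text \<open>
  The size of the subtree of the \<open>k\<close>-th ancestor increases by growth or, for a new vertex, is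
  created: the \<open>k\<close>-th ancestor of a new vertex is the \<open>k - 1 + z\<close>-th ancestor of the chosen one.
  In terms of codes, the positions of depth \<open>k\<close> in \<open>ps @ [j]\<close> are those of \<open>ps\<close> and possibly the
  new one.
\<close>

lemma layer_balance_Suc:
  "layer_mass p k (Suc l) + layer_flux p k (Suc l) = layer_flux p k l +
     (if k = 0 then 0 else measure_pmf.expectation p (\<lambda>z. layer_mass p (k - 1 + z) l))"
proof -
  have "layer_mass p k (Suc l) + layer_flux p k (Suc l) =
      (\<Sum>ps\<in>codes (Suc l). real (layer k ps) * ((1 + total_birth p ps) * fringe_freq p ps))"
    by (simp add: layer_mass_def layer_flux_def algebra_simps flip: sum.distrib)
  also have "\<dots> = (\<Sum>ps\<in>codes l. \<Sum>j\<le>l. real (layer k (ps @ [j])) * (birth p ps j * fringe_freq p ps))"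
    by (simp add: sum_codes_Suc fringe_freq_snoc)
  also have "\<dots> = (\<Sum>ps\<in>codes l. real (layer k ps) * total_birth p ps * fringe_freq p ps +
      (if k = 0 then 0 else measure_pmf.expectation p (\<lambda>z. real (layer (k - 1 + z) ps) * fringe_freq p ps)))"
  proof (intro sum.cong refl)
    fix ps assume "ps \<in> codes l"
    then have ps: "rec_code ps" "length ps = l" by (auto simp: codes_def)
    have "(\<Sum>j\<le>l. real (layer k (ps @ [j])) * (birth p ps j * fringe_freq p ps)) =
        (\<Sum>j\<le>l. (real (layer k ps) * fringe_freq p ps) * birth p ps j +
           fringe_freq p ps * ((if k = Suc (level ps j) then 1 else 0) * birth p ps j))"
      using ps by (intro sum.cong) (auto simp: layer_snoc algebra_simps)
    also have "\<dots> = (real (layer k ps) * fringe_freq p ps) * total_birth p ps +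
        fringe_freq p ps * (\<Sum>j\<le>l. (if k = Suc (level ps j) then 1 else 0) * birth p ps j)"
      using ps by (simp only: sum.distrib total_birth_def flip: sum_distrib_left)
    also have "(\<Sum>j\<le>l. (if k = Suc (level ps j) then 1 else 0) * birth p ps j) =
        (if k = 0 then 0 else measure_pmf.expectation p (\<lambda>z. real (layer (k - 1 + z) ps)))"
    proof (cases k)
      case (Suc k')
      then show ?thesis using birth_in_layer[OF ps(1), of k' p] ps(2) by (simp add: eq_commute cong: if_cong)
    qed simp
    finally show "(\<Sum>j\<le>l. real (layer k (ps @ [j])) * (birth p ps j * fringe_freq p ps)) =
        real (layer k ps) * total_birth p ps * fringe_freq p ps +
        (if k = 0 then 0 else measure_pmf.expectation p (\<lambda>z. real (layer (k - 1 + z) ps) * fringe_freq p ps))"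
      by (simp add: mult_ac)
  qed
  also have "\<dots> = layer_flux p k l +
     (if k = 0 then 0 else measure_pmf.expectation p (\<lambda>z. layer_mass p (k - 1 + z) l))"
    by (simp add: layer_flux_def layer_mass_def sum.distrib Bochner_Integration.integral_sum)
  finally show ?thesis .
qed

lemma integrable_layer_mass: "integrable (measure_pmf p) (\<lambda>z. layer_mass p (k + z) l)"
  unfolding layer_mass_def by (intro Bochner_Integration.integrable_sum integrable_mult_left integrable_layer)

definition cum_mass :: "nat pmf \<Rightarrow> nat \<Rightarrow> nat \<Rightarrow> real" where
  "cum_mass p k M = (\<Sum>l\<le>M. layer_mass p k l)"

lemma integrable_cum_mass: "integrable (measure_pmf p) (\<lambda>z. cum_mass p (k + z) l)"
  unfolding cum_mass_def by (intro Bochner_Integration.integrable_sum integrable_layer_mass)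

lemma cum_mass_0: "cum_mass p 0 M + layer_flux p 0 M = 1"
proof (induction M)
  case 0
  then show ?case using layer_balance_0[of p 0] by (simp add: cum_mass_def)
next
  case (Suc M)
  then show ?case using layer_balance_Suc[of p 0 M] by (simp add: cum_mass_def)
qed

text \<open>
  Telescoping of the balance equations; only the flux out of the last size remains.
\<close>

lemma cum_mass_Suc:
  "cum_mass p (Suc k) (Suc M) + layer_flux p (Suc k) (Suc M) =
   measure_pmf.expectation p (\<lambda>z. cum_mass p (k + z) M)"
proof (induction M)
  case 0
  then show ?case
    using layer_balance_0[of p "Suc k"] layer_balance_Suc[of p "Suc k" 0] by (simp add: cum_mass_def)
next
  case (Suc M)
  have "measure_pmf.expectation p (\<lambda>z. cum_mass p (k + z) (Suc M)) =
      measure_pmf.expectation p (\<lambda>z. cum_mass p (k + z) M) + measure_pmf.expectation p (\<lambda>z. layer_mass p (k + z) (Suc M))"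
    using integrable_cum_mass[of p k M] integrable_layer_mass[of p k "Suc M"]
    by (simp add: cum_mass_def)
  moreover have "cum_mass p (Suc k) (Suc (Suc M)) = cum_mass p (Suc k) (Suc M) + layer_mass p (Suc k) (Suc (Suc M))"
    by (simp add: cum_mass_def)
  ultimately show ?case using Suc layer_balance_Suc[of p "Suc k" "Suc M"] by simp
qed

lemma cum_mass_nonneg: "0 \<le> cum_mass p k M"
  by (simp add: cum_mass_def sum_nonneg layer_mass_nonneg)

text \<open>
  Without the flux, the recursion averages values that are at most one.
\<close>

lemma cum_mass_le_1: "cum_mass p k M \<le> 1"
proof (induction M arbitrary: k)
  case 0
  then show ?case using layer_balance_0[of p k] layer_flux_nonneg[of p k 0]
    by (simp add: cum_mass_def split: if_splits)
next
  case (Suc M)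
  show ?case
  proof (cases k)
    case 0
    then show ?thesis using cum_mass_0[of p "Suc M"] layer_flux_nonneg[of p 0 "Suc M"] by simp
  next
    case (Suc k')
    have "measure_pmf.expectation p (\<lambda>z. cum_mass p (k' + z) M) \<le> measure_pmf.expectation p (\<lambda>z. 1)"
      using Suc.IH by (intro integral_mono integrable_cum_mass) auto
    then show ?thesis using cum_mass_Suc[of p k' M] layer_flux_nonneg[of p k "Suc M"] Suc by simp
  qed
qed

lemma incseq_cum_mass: "incseq (cum_mass p k)"
  by (rule incseq_SucI) (simp add: cum_mass_def layer_mass_nonneg)

text \<open>
  The limiting proportion of vertices for which the subtree of the \<open>k\<close>-th ancestor stays of bounded
  size.
\<close>

definition full_mass :: "nat pmf \<Rightarrow> nat \<Rightarrow> real" where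
  "full_mass p k = (SUP M. cum_mass p k M)"

lemma cum_mass_tendsto: "cum_mass p k \<longlonglongrightarrow> full_mass p k"
  unfolding full_mass_def
  by (rule LIMSEQ_incseq_SUP[OF _ incseq_cum_mass]) (auto intro: bdd_aboveI2 cum_mass_le_1)

lemma full_mass_bounds: "0 \<le> full_mass p k" "full_mass p k \<le> 1"
  using LIMSEQ_le_const[OF cum_mass_tendsto] LIMSEQ_le_const2[OF cum_mass_tendsto]
    cum_mass_nonneg cum_mass_le_1 by blast+

text \<open>
  A positive limit would make \<open>g\<close> dominate a multiple of the harmonic series.
\<close>

lemma flux_limit_zero:
  fixes g H :: "nat \<Rightarrow> real"
  assumes g: "summable g" and H: "\<And>l. H l \<le> real (Suc l) * g l" "\<And>l. 0 \<le> H l" and h: "H \<longlonglongrightarrow> h"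
  shows "h = 0"
proof (rule ccontr)
  assume "h \<noteq> 0"
  moreover have "0 \<le> h" using LIMSEQ_le_const[OF h] H(2) by blast
  ultimately have "0 < h" by simp
  then have "eventually (\<lambda>l. h / 2 < H l) sequentially" by (intro order_tendstoD(1)[OF h]) simp
  then have "eventually (\<lambda>l. norm (1 / real (Suc l)) \<le> 2 / h * g l) sequentially"
  proof eventually_elim
    case (elim l)
    then have "h / 2 \<le> real (Suc l) * g l" using H(1)[of l] by simp
    then show ?case using \<open>0 < h\<close> by (simp add: field_simps)
  qed
  then have "summable (\<lambda>l. 1 / real (Suc l))"
    by (rule summable_comparison_test_ev) (intro summable_mult g)
  then show False using not_summable_harmonic[where 'a = real] by (subst (asm) summable_Suc_iff) (simp add: inverse_eq_divide)
qed

lemma layer_flux_limit_zero: "layer_flux p k \<longlonglongrightarrow> h \<Longrightarrow> h = 0"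
proof (rule flux_limit_zero)
  show "summable (layer_mass p k)"
    using cum_mass_tendsto[of p k] unfolding summable_def sums_def_le cum_mass_def[abs_def] by auto
qed (assumption | rule layer_flux_le layer_flux_nonneg)+

lemma full_mass_0: "full_mass p 0 = 1"
proof -
  have "layer_flux p 0 = (\<lambda>M. 1 - cum_mass p 0 M)" using cum_mass_0[of p] by (auto simp: fun_eq_iff algebra_simps)
  moreover have "(\<lambda>M. 1 - cum_mass p 0 M) \<longlonglongrightarrow> 1 - full_mass p 0"
    by (intro tendsto_intros cum_mass_tendsto)
  ultimately have "1 - full_mass p 0 = 0" by (intro layer_flux_limit_zero[of p 0]) simp
  then show ?thesis by simp
qed

text \<open>
  The flux to infinity vanishes, so the total masses satisfy the balance equation exactly: they are
  harmonic for the random walk with steps \<open>Z - 1\<close>.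
\<close>

lemma full_mass_Suc: "full_mass p (Suc k) = measure_pmf.expectation p (\<lambda>z. full_mass p (k + z))"
proof -
  have "(\<lambda>M. measure_pmf.expectation p (\<lambda>z. cum_mass p (k + z) M)) \<longlonglongrightarrow>
      measure_pmf.expectation p (\<lambda>z. full_mass p (k + z))"
    by (rule integral_dominated_convergence[where w = "\<lambda>_. 1"])
       (auto simp: cum_mass_tendsto cum_mass_nonneg cum_mass_le_1)
  then have "(\<lambda>M. measure_pmf.expectation p (\<lambda>z. cum_mass p (k + z) M) - cum_mass p (Suc k) (Suc M)) \<longlonglongrightarrow>
      measure_pmf.expectation p (\<lambda>z. full_mass p (k + z)) - full_mass p (Suc k)"
    by (intro tendsto_diff) (auto intro: LIMSEQ_Suc cum_mass_tendsto)
  then have "(\<lambda>M. layer_flux p (Suc k) (Suc M)) \<longlonglongrightarrow>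
      measure_pmf.expectation p (\<lambda>z. full_mass p (k + z)) - full_mass p (Suc k)"
    by (simp flip: cum_mass_Suc)
  then have "measure_pmf.expectation p (\<lambda>z. full_mass p (k + z)) - full_mass p (Suc k) = 0"
    by (intro layer_flux_limit_zero) (rule LIMSEQ_imp_Suc)
  then show ?thesis by simp
qed

lemma mean_le_1_integrable:
  assumes "(\<integral>\<^sup>+ k. of_nat k \<partial>measure_pmf p) \<le> 1"
  shows "integrable (measure_pmf p) real" "measure_pmf.expectation p real \<le> 1"
proof -
  have eq: "(\<integral>\<^sup>+ k. of_nat k \<partial>measure_pmf p) = (\<integral>\<^sup>+ k. ennreal (real k) \<partial>measure_pmf p)"
    by (simp add: ennreal_of_nat_eq_real_of_nat)
  show i: "integrable (measure_pmf p) real"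
    using assms le_less_trans[OF _ ennreal_one_less_top] unfolding eq
    by (intro integrableI_nonneg) auto
  then have "ennreal (measure_pmf.expectation p real) \<le> 1"
    using assms unfolding eq by (subst nn_integral_eq_integral[symmetric]) auto
  then show "measure_pmf.expectation p real \<le> 1" by simp
qed

text \<open>
  A law on the positive integers has mean at least \<open>1\<close>, with equality only for the point mass.
\<close>

lemma zero_in_support:
  assumes mean: "(\<integral>\<^sup>+ k. of_nat k \<partial>measure_pmf p) \<le> 1" and "p \<noteq> return_pmf 1"
  shows "0 \<in> set_pmf p"
proof (rule ccontr)
  assume 0: "0 \<notin> set_pmf p"
  note m = mean_le_1_integrable[OF mean]
  have nn: "AE z in measure_pmf p. 0 \<le> real z - 1"
  proof (rule AE_pmfI)
    fix z assume "z \<in> set_pmf p"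
    then have "z \<noteq> 0" using 0 by metis
    then show "0 \<le> real z - 1" by simp
  qed
  have "measure_pmf.expectation p (\<lambda>z. real z - 1) \<le> 0" using m by simp
  moreover have "0 \<le> measure_pmf.expectation p (\<lambda>z. real z - 1)" by (rule integral_nonneg_AE[OF nn])
  ultimately have "AE z in measure_pmf p. real z - 1 = 0"
    using m(1) nn by (subst integral_nonneg_eq_0_iff_AE[symmetric]) auto
  then have "set_pmf p \<subseteq> {1}" by (auto simp: AE_measure_pmf_iff)
  then show False using assms(2) by (simp add: set_pmf_subset_singleton)
qed

text \<open>
  The random walk with steps \<open>Z - 1\<close> has no upward drift and moves down with positive probability,
  so it hits \<open>0\<close> almost surely, and a bounded harmonic function takes its value at \<open>0\<close> everywhere.
  The argument is the maximum principle for \<open>1 - q j - \<epsilon> j\<close>: the mean bound makes \<open>j\<close>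
  superharmonic, so this function is subharmonic, and it is negative for large \<open>j\<close>.
\<close>

lemma bounded_harmonic_eq_1:
  fixes q :: "nat \<Rightarrow> real"
  assumes mean: "(\<integral>\<^sup>+ k. of_nat k \<partial>measure_pmf p) \<le> 1" and nd: "p \<noteq> return_pmf 1"
    and q: "\<And>k. 0 \<le> q k" "\<And>k. q k \<le> 1" "q 0 = 1"
    and harm: "\<And>k. q (Suc k) = measure_pmf.expectation p (\<lambda>z. q (k + z))"
  shows "q k = 1"
proof (rule ccontr)
  assume "q k \<noteq> 1"
  then have k: "q k < 1" "0 < k" using q(2)[of k] q(3) by (auto intro!: gr0I)
  \<comment> \<open>Small enough to keep the perturbed function positive at \<open>k\<close>.\<close>
  define \<epsilon> where "\<epsilon> = (1 - q k) / (2 * real k)"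
  have \<epsilon>: "0 < \<epsilon>" "\<epsilon> * real k = (1 - q k) / 2" using k by (auto simp: \<epsilon>_def)
  define f where "f j = 1 - q j - \<epsilon> * real j" for j
  obtain J where J: "1 < real J * \<epsilon>" using reals_Archimedean3[OF \<epsilon>(1)] by blast
  define m where "m = Max (f ` {..J + k})"
  have "f k \<le> m" unfolding m_def by (rule Max_ge) auto
  moreover have "0 < f k" using k \<epsilon> by (simp add: f_def)
  ultimately have m: "0 < m" by simp
  have le: "f j \<le> m" for j
  proof (cases "j \<le> J + k")
    case True
    then show ?thesis unfolding m_def by (intro Max_ge) auto
  next
    case False
    then have "\<epsilon> * real J \<le> \<epsilon> * real j" using \<epsilon> by (intro mult_left_mono) auto
    then have "f j \<le> 0" using J q(1)[of j] by (simp add: f_def mult.commute)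
    then show ?thesis using m by simp
  qed
  have "m \<in> f ` {..J + k}" unfolding m_def by (rule Max_in) auto
  then obtain i0 where "f i0 = m" by auto
  \<comment> \<open>At the leftmost maximum, a step down, which has positive probability, strictly decreases \<open>f\<close>.\<close>
  define i where "i = (LEAST i. f i = m)"
  have i: "f i = m" unfolding i_def by (rule LeastI) fact
  have "f 0 = 0" using q(3) by (simp add: f_def)
  then have "i \<noteq> 0" using i m by (metis less_irrefl)
  then obtain i' where i': "i = Suc i'" by (cases i) auto
  have "f i' \<noteq> m" using not_less_Least[of i' "\<lambda>i. f i = m"] i' by (simp add: i_def)
  then have lt: "f i' < m" using le[of i'] by simp
  note mz = mean_le_1_integrable[OF mean]
  have iq: "integrable (measure_pmf p) (\<lambda>z. q (i' + z))"
    using q by (intro integrable_pmf_bounded[where B = 1]) auto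
  have fi: "integrable (measure_pmf p) (\<lambda>z. f (i' + z))"
    unfolding f_def using iq mz(1) by (simp add: distrib_left)
  have "measure_pmf.expectation p (\<lambda>z. f (i' + z)) =
      1 - q i - \<epsilon> * (real i' + measure_pmf.expectation p real)"
    unfolding f_def i' harm using iq mz(1) by (simp add: distrib_left)
  also have "\<dots> \<ge> f i"
    using mz(2) \<epsilon>(1) by (auto simp: f_def i' intro!: mult_left_mono)
  finally have "measure_pmf.expectation p (\<lambda>z. m - f (i' + z)) \<le> 0" using i fi by simp
  moreover have "0 \<le> measure_pmf.expectation p (\<lambda>z. m - f (i' + z))"
    using le by (intro integral_nonneg_AE) auto
  ultimately have "AE z in measure_pmf p. m - f (i' + z) = 0"
    using fi le by (subst integral_nonneg_eq_0_iff_AE[symmetric]) auto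
  then have "m - f (i' + 0) = 0" using zero_in_support[OF mean nd] unfolding AE_measure_pmf_iff by blast
  then show False using lt by simp
qed

text \<open>
  This is the place where the bound on the mean enters. Without it, the walk could escape to
  infinity, and a positive proportion of vertices would sit close to the root or below ancestors
  with giant subtrees.
\<close>

theorem full_mass_eq_1:
  assumes "(\<integral>\<^sup>+ k. of_nat k \<partial>measure_pmf p) \<le> 1" "p \<noteq> return_pmf 1"
  shows "full_mass p k = 1"
  by (rule bounded_harmonic_eq_1[OF assms])
     (auto simp: full_mass_bounds full_mass_0 full_mass_Suc)

section \<open>The limiting fringe laws\<close>

text \<open>
  A tree with a marked vertex of depth \<open>k\<close>. Equivalently, it is an extended fringe of depth \<open>k\<close> in which
  the order of arrival is remembered.
\<close>

definition marked_codes :: "nat \<Rightarrow> (nat list \<times> nat) set" where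
  "marked_codes k = {(ps, x). rec_code ps \<and> x \<le> length ps \<and> level ps x = k}"

definition marked_weight :: "nat pmf \<Rightarrow> nat \<Rightarrow> nat list \<times> nat \<Rightarrow> real" where
  "marked_weight p k m = (if m \<in> marked_codes k then fringe_freq p (fst m) else 0)"

definition marked_law :: "nat pmf \<Rightarrow> nat \<Rightarrow> (nat list \<times> nat) pmf" where
  "marked_law p k = embed_pmf (marked_weight p k)"

text \<open>
  The law of the first \<open>k + 1\<close> trees of the limiting sin-tree. Each position of depth \<open>k\<close> in a code
  is the mark of as many vertices as there are subtrees with that code, so a marked code has weight
  \<open>fringe_freq\<close> whatever the mark.
\<close>

definition fringe_law :: "nat pmf \<Rightarrow> nat \<Rightarrow> rtree list pmf" where
  "fringe_law p k = map_pmf (\<lambda>(ps, x). ext_fringe k x (ctree ps)) (marked_law p k)"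

lemma marked_weight_nonneg: "0 \<le> marked_weight p k m"
  by (simp add: marked_weight_def fringe_freq_nonneg)

text \<open>
  Sort the marked codes by length; each length contributes one \<open>layer_mass\<close>.
\<close>

lemma marked_weight_total:
  assumes "full_mass p k = 1"
  shows "(\<integral>\<^sup>+ m. ennreal (marked_weight p k m) \<partial>count_space UNIV) = 1"
proof -
  define B where "B l = (SIGMA ps:codes l. {x. x \<le> length ps \<and> level ps x = k})" for l
  have finB: "finite (B l)" for l unfolding B_def by (intro finite_SigmaI) auto
  have split: "ennreal (marked_weight p k m) = (\<Sum>l. ennreal (marked_weight p k m) * indicator (B l) m)" for m
  proof -
    obtain ps x where m: "m = (ps, x)" by (cases m)
    have "(\<Sum>l. ennreal (marked_weight p k m) * indicator (B l) m) =
        (\<Sum>l\<in>{length ps}. ennreal (marked_weight p k m) * indicator (B l) m)"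
      by (rule suminf_finite) (auto simp: m B_def codes_def indicator_def)
    then show ?thesis by (auto simp: m B_def codes_def indicator_def marked_weight_def marked_codes_def)
  qed
  have layer: "(\<integral>\<^sup>+ m. ennreal (marked_weight p k m) * indicator (B l) m \<partial>count_space UNIV) =
      ennreal (layer_mass p k l)" for l
  proof -
    have "(\<integral>\<^sup>+ m. ennreal (marked_weight p k m) * indicator (B l) m \<partial>count_space UNIV) =
        (\<Sum>m\<in>B l. ennreal (marked_weight p k m) * indicator (B l) m)"
      by (rule nn_integral_count_space'[OF finB]) auto
    also have "\<dots> = (\<Sum>m\<in>B l. ennreal (fringe_freq p (fst m)))"
      by (intro sum.cong) (auto simp: B_def marked_weight_def marked_codes_def codes_def)
    also have "\<dots> = ennreal (\<Sum>m\<in>B l. fringe_freq p (fst m))"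
      by (rule sum_ennreal) (simp add: fringe_freq_nonneg)
    also have "(\<Sum>m\<in>B l. fringe_freq p (fst m)) =
        (\<Sum>ps\<in>codes l. \<Sum>x\<in>{x. x \<le> length ps \<and> level ps x = k}. fringe_freq p ps)"
      unfolding B_def by (subst sum.Sigma) (auto simp: case_prod_beta)
    also have "\<dots> = layer_mass p k l" by (simp add: layer_mass_def layer_def)
    finally show ?thesis .
  qed
  have "(\<integral>\<^sup>+ m. ennreal (marked_weight p k m) \<partial>count_space UNIV) =
      (\<Sum>l. \<integral>\<^sup>+ m. ennreal (marked_weight p k m) * indicator (B l) m \<partial>count_space UNIV)"
    by (subst split) (rule nn_integral_suminf, simp)
  also have "\<dots> = (\<Sum>l. ennreal (layer_mass p k l))" by (simp add: layer)
  also have "\<dots> = ennreal 1"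
  proof (rule suminf_ennreal_eq)
    show "layer_mass p k sums 1"
      using cum_mass_tendsto[of p k] assms unfolding sums_def_le cum_mass_def[abs_def] by simp
  qed (rule layer_mass_nonneg)
  finally show ?thesis by simp
qed

lemma pmf_marked_law: "full_mass p k = 1 \<Longrightarrow> pmf (marked_law p k) m = marked_weight p k m"
  unfolding marked_law_def
  by (rule pmf_embed_pmf) (auto simp: marked_weight_nonneg marked_weight_total)

lemma set_marked_law: "full_mass p k = 1 \<Longrightarrow> set_pmf (marked_law p k) \<subseteq> marked_codes k"
  by (auto simp: set_pmf_iff pmf_marked_law marked_weight_def split: if_splits)

lemma set_fringe_law:
  assumes "full_mass p k = 1" "s \<in> set_pmf (fringe_law p k)"
  shows "length s = Suc k" "empty_tree \<notin> set s"
proof -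
  obtain ps x where "(ps, x) \<in> marked_codes k" "s = ext_fringe k x (ctree ps)"
    using assms set_marked_law[OF assms(1)] by (auto simp: fringe_law_def)
  then show "length s = Suc k" "empty_tree \<notin> set s"
    using ext_fringe_nonempty_iff[of ps x k] by (auto simp: marked_codes_def, simp add: ext_fringe_def)
qed

lemma pmf_fringe_law:
  assumes full: "full_mass p k = 1" and l: "l = sum_list (map tree_size s) - 1"
  shows "pmf (fringe_law p k) s = (\<Sum>ps\<in>codes l. real (card (marks k s ps)) * fringe_freq p ps)"
proof -
  let ?A = "(\<lambda>(ps, x). ext_fringe k x (ctree ps)) -` {s}"
  let ?S = "SIGMA ps:codes l. marks k s ps"
  have "pmf (fringe_law p k) s = measure (marked_law p k) ?A"
    by (simp add: fringe_law_def pmf_map)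
  also have "\<dots> = measure (marked_law p k) ?S"
  proof (rule measure_prob_cong_0)
    fix m assume m: "m \<in> ?A - ?S"
    show "pmf (marked_law p k) m = 0"
    proof (rule ccontr)
      assume "pmf (marked_law p k) m \<noteq> 0"
      then have "m \<in> marked_codes k" using set_marked_law[OF full] by (auto simp: set_pmf_iff)
      then obtain ps x where ps: "m = (ps, x)" "rec_code ps" "x \<in> marks k s ps"
        using m by (auto simp: marked_codes_def marks_def)
      then have "ps \<in> codes l" using marks_length[of ps x k s] l by (simp add: codes_def)
      then show False using m ps by simp
    qed
  qed (auto simp: marks_def)
  also have "\<dots> = (\<Sum>m\<in>?S. pmf (marked_law p k) m)"
    by (rule measure_measure_pmf_finite) (intro finite_SigmaI, auto)
  also have "\<dots> = (\<Sum>m\<in>?S. fringe_freq p (fst m))"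
    using full by (intro sum.cong) (auto simp: pmf_marked_law marked_weight_def marked_codes_def codes_def marks_def)
  also have "\<dots> = (\<Sum>ps\<in>codes l. \<Sum>x\<in>marks k s ps. fringe_freq p ps)"
    by (subst sum.Sigma) (auto simp: case_prod_beta)
  finally show ?thesis by simp
qed

theorem fringe_proportion_limit:
  assumes full: "full_mass p k = 1" and s: "empty_tree \<notin> set s"
  shows "(\<lambda>n. measure_pmf.expectation (chain p n)
    (\<lambda>T. \<bar>fringe_proportion k s (ctree T) - pmf (fringe_law p k) s\<bar>)) \<longlonglongrightarrow> 0"
proof -
  define l where "l = sum_list (map tree_size s) - 1"
  let ?c = "\<lambda>ps. real (card (marks k s ps))"
  let ?e = "\<lambda>n ps. measure_pmf.expectation (chain p n) (\<lambda>T. \<bar>real (occurrences T ps) / real (Suc n) - fringe_freq p ps\<bar>)"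
  have "measure_pmf.expectation (chain p n) (\<lambda>T. \<bar>fringe_proportion k s (ctree T) - pmf (fringe_law p k) s\<bar>)
      \<le> (\<Sum>ps\<in>codes l. ?c ps * ?e n ps)" if n: "l < n" for n
  proof -
    have "measure_pmf.expectation (chain p n) (\<lambda>T. \<bar>fringe_proportion k s (ctree T) - pmf (fringe_law p k) s\<bar>)
      \<le> measure_pmf.expectation (chain p n)
          (\<lambda>T. \<Sum>ps\<in>codes l. ?c ps * \<bar>real (occurrences T ps) / real (Suc n) - fringe_freq p ps\<bar>)"
    proof (intro integral_mono_AE AE_pmfI)
      fix T assume "T \<in> set_pmf (chain p n)"
      then have T: "rec_code T" "length T = n" using set_chain[of p n] by (auto simp: codes_def)
      have "fringe_proportion k s (ctree T) = real (\<Sum>ps\<in>codes l. card (marks k s ps) * occurrences T ps) / real (Suc n)"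
        unfolding fringe_proportion_def using fringe_card_occurrences[OF T(1) s l_def] T(2) n by simp
      then have "fringe_proportion k s (ctree T) - pmf (fringe_law p k) s =
          (\<Sum>ps\<in>codes l. ?c ps * (real (occurrences T ps) / real (Suc n) - fringe_freq p ps))"
        unfolding pmf_fringe_law[OF full l_def] by (simp add: sum_divide_distrib right_diff_distrib sum_subtractf)
      also have "\<bar>\<dots>\<bar> \<le> (\<Sum>ps\<in>codes l. \<bar>?c ps * (real (occurrences T ps) / real (Suc n) - fringe_freq p ps)\<bar>)"
        by (rule sum_abs)
      finally show "\<bar>fringe_proportion k s (ctree T) - pmf (fringe_law p k) s\<bar> \<le>
          (\<Sum>ps\<in>codes l. ?c ps * \<bar>real (occurrences T ps) / real (Suc n) - fringe_freq p ps\<bar>)"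
        by (simp only: abs_mult abs_of_nat)
    qed auto
    also have "\<dots> = (\<Sum>ps\<in>codes l. ?c ps * ?e n ps)"
      by (subst Bochner_Integration.integral_sum) auto
    finally show ?thesis .
  qed
  then have "\<forall>\<^sub>F n in sequentially. measure_pmf.expectation (chain p n)
      (\<lambda>T. \<bar>fringe_proportion k s (ctree T) - pmf (fringe_law p k) s\<bar>) \<le> (\<Sum>ps\<in>codes l. ?c ps * ?e n ps)"
    by (rule eventually_mono[OF eventually_gt_at_top[of l]])
  moreover have "(\<lambda>n. \<Sum>ps\<in>codes l. ?c ps * ?e n ps) \<longlonglongrightarrow> 0"
    by (intro tendsto_null_sum tendsto_mult_right_zero occurrences_limit) (auto simp: codes_def)
  ultimately show ?thesis
    by (rule tendsto_sandwich[OF always_eventually _ tendsto_const, rotated]) simp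
qed

lemma fringe_proportion_mean_limit:
  assumes full: "full_mass p k = 1" and s: "empty_tree \<notin> set s"
  shows "(\<lambda>n. measure_pmf.expectation (chain p n) (\<lambda>T. fringe_proportion k s (ctree T)))
    \<longlonglongrightarrow> pmf (fringe_law p k) s"
proof -
  have "(\<lambda>n. measure_pmf.expectation (chain p n) (\<lambda>T. fringe_proportion k s (ctree T)) - pmf (fringe_law p k) s) \<longlonglongrightarrow> 0"
  proof (rule Lim_null_comparison[OF always_eventually fringe_proportion_limit[OF full s]], rule allI)
    fix n
    have "measure_pmf.expectation (chain p n) (\<lambda>T. fringe_proportion k s (ctree T)) - pmf (fringe_law p k) s =
        measure_pmf.expectation (chain p n) (\<lambda>T. fringe_proportion k s (ctree T) - pmf (fringe_law p k) s)"
      by simp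
    then show "norm (measure_pmf.expectation (chain p n) (\<lambda>T. fringe_proportion k s (ctree T)) - pmf (fringe_law p k) s)
      \<le> measure_pmf.expectation (chain p n) (\<lambda>T. \<bar>fringe_proportion k s (ctree T) - pmf (fringe_law p k) s\<bar>)"
      using integral_norm_bound[of "chain p n" "\<lambda>T. fringe_proportion k s (ctree T) - pmf (fringe_law p k) s"]
      by simp
  qed
  then show ?thesis by (rule LIM_zero_cancel)
qed

text \<open>
  A fringe of depth \<open>k + 1\<close> determines the one of depth \<open>k\<close>.
\<close>

lemma sum_fringe_proportion_le:
  assumes F: "finite F" "\<And>l. l \<in> F \<Longrightarrow> butlast l = s"
  shows "(\<Sum>l\<in>F. fringe_proportion (Suc k) l (ctree T)) \<le> fringe_proportion k s (ctree T)"
proof -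
  let ?V = "\<lambda>l. {v \<in> verts (ctree T). ext_fringe (Suc k) v (ctree T) = l}"
  have "(\<Sum>l\<in>F. card (?V l)) = card (\<Union>l\<in>F. ?V l)"
    by (rule card_UN_disjoint[symmetric]) (use F in auto)
  also have "\<dots> \<le> card {v \<in> verts (ctree T). ext_fringe k v (ctree T) = s}"
  proof (rule card_mono)
    show "(\<Union>l\<in>F. ?V l) \<subseteq> {v \<in> verts (ctree T). ext_fringe k v (ctree T) = s}"
    proof
      fix v assume "v \<in> (\<Union>l\<in>F. ?V l)"
      then have v: "v \<in> verts (ctree T)" "butlast (ext_fringe (Suc k) v (ctree T)) = s" using F(2) by auto
      have "butlast (ext_fringe (Suc k) v (ctree T)) = ext_fringe k v (ctree T)"
        by (simp add: ext_fringe_def butlast_append)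
      then show "v \<in> {v \<in> verts (ctree T). ext_fringe k v (ctree T) = s}" using v by simp
    qed
  qed simp
  finally have "real (\<Sum>l\<in>F. card (?V l)) \<le> real (card {v \<in> verts (ctree T). ext_fringe k v (ctree T) = s})"
    by (simp only: of_nat_le_iff)
  then show ?thesis unfolding fringe_proportion_def
    by (simp add: divide_right_mono flip: sum_divide_distrib)
qed

text \<open>
  Passing to the limit in finite sums of proportions gives one inequality between the two mass
  functions. As both have total mass \<open>1\<close>, there is equality.
\<close>

lemma fringe_law_consistent:
  assumes full: "\<And>k. full_mass p k = 1"
  shows "map_pmf butlast (fringe_law p (Suc k)) = fringe_law p k"
proof (rule ccontr)
  let ?Q = "fringe_law p (Suc k)"
  assume "map_pmf butlast ?Q \<noteq> fringe_law p k"
  then obtain s where s: "pmf (fringe_law p k) s < pmf (map_pmf butlast ?Q) s"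
    using pmf_neq_exists_less[of "fringe_law p k" "map_pmf butlast ?Q"] by metis
  have fin: "(\<Sum>l\<in>F. pmf ?Q l) \<le> pmf (fringe_law p k) s" if F: "finite F" "F \<subseteq> butlast -` {s}" for F
  proof -
    define F' where "F' = F \<inter> set_pmf ?Q"
    have F': "finite F'" "\<And>l. l \<in> F' \<Longrightarrow> butlast l = s" using F by (auto simp: F'_def)
    have ne: "empty_tree \<notin> set l" if "l \<in> F'" for l
      using set_fringe_law[OF full] that by (auto simp: F'_def)
    have "(\<Sum>l\<in>F. pmf ?Q l) = (\<Sum>l\<in>F'. pmf ?Q l)"
      using F by (intro sum.mono_neutral_right) (auto simp: F'_def set_pmf_iff)
    also have "\<dots> \<le> pmf (fringe_law p k) s"
    proof (cases "F' = {}")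
      case False
      then obtain l where "l \<in> F'" by auto
      then have s0: "empty_tree \<notin> set s" using ne F'(2) by (metis in_set_butlastD)
      show ?thesis
      proof (rule LIMSEQ_le)
        show "(\<lambda>n. \<Sum>l\<in>F'. measure_pmf.expectation (chain p n) (\<lambda>T. fringe_proportion (Suc k) l (ctree T)))
            \<longlonglongrightarrow> (\<Sum>l\<in>F'. pmf ?Q l)"
          using ne by (intro tendsto_sum fringe_proportion_mean_limit full)
        show "(\<lambda>n. measure_pmf.expectation (chain p n) (\<lambda>T. fringe_proportion k s (ctree T)))
            \<longlonglongrightarrow> pmf (fringe_law p k) s"
          by (rule fringe_proportion_mean_limit[OF full s0])
        have "(\<Sum>l\<in>F'. measure_pmf.expectation (chain p n) (\<lambda>T. fringe_proportion (Suc k) l (ctree T)))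
            \<le> measure_pmf.expectation (chain p n) (\<lambda>T. fringe_proportion k s (ctree T))" for n
        proof -
          have "(\<Sum>l\<in>F'. measure_pmf.expectation (chain p n) (\<lambda>T. fringe_proportion (Suc k) l (ctree T))) =
              measure_pmf.expectation (chain p n) (\<lambda>T. \<Sum>l\<in>F'. fringe_proportion (Suc k) l (ctree T))"
            by (rule Bochner_Integration.integral_sum[symmetric]) simp
          then show ?thesis
            using sum_fringe_proportion_le[OF F', of k] by (simp only:) (rule integral_mono, auto)
        qed
        then show "\<exists>N. \<forall>n\<ge>N. (\<Sum>l\<in>F'. measure_pmf.expectation (chain p n) (\<lambda>T. fringe_proportion (Suc k) l (ctree T)))
            \<le> measure_pmf.expectation (chain p n) (\<lambda>T. fringe_proportion k s (ctree T))" by blast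
      qed
    qed simp
    finally show ?thesis .
  qed
  have "pmf (map_pmf butlast ?Q) s = infsetsum (pmf ?Q) (butlast -` {s})"
    by (simp add: pmf_map measure_pmf_conv_infsetsum)
  also have "\<dots> = infsum (pmf ?Q) (butlast -` {s})"
    by (intro infsetsum_infsum pmf_abs_summable)
  also have "\<dots> \<le> pmf (fringe_law p k) s"
  proof (rule infsum_le_finite_sums[OF _ fin])
    show "pmf ?Q summable_on butlast -` {s}"
      using pmf_abs_summable[of ?Q "butlast -` {s}"] abs_summable_summable abs_summable_equivalent by blast
  qed
  finally show False using s by simp
qed

section \<open>Projective limits of laws of finite sequences\<close>

text \<open>
  \<open>\<kappa> l\<close> is the conditional law of the last entry given that the others are \<open>l\<close>.
\<close>

lemma pmf_extension_step:
  fixes P Q :: "'a list pmf"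
  assumes cons: "map_pmf butlast Q = P" and ne: "[] \<notin> set_pmf Q"
  shows "\<exists>\<kappa>. \<forall>l a. pmf Q (l @ [a]) = pmf P l * pmf (\<kappa> l) a"
proof -
  define \<kappa> where "\<kappa> l = map_pmf last (cond_pmf Q {y. butlast y = l})" for l
  have "pmf Q (l @ [a]) = pmf P l * pmf (\<kappa> l) a" for l a
  proof (cases "l \<in> set_pmf P")
    case False
    have "l @ [a] \<notin> set_pmf Q"
    proof
      assume "l @ [a] \<in> set_pmf Q"
      then have "butlast (l @ [a]) \<in> set_pmf (map_pmf butlast Q)" unfolding set_map_pmf by blast
      then show False using False cons by simp
    qed
    then show ?thesis using False by (simp add: set_pmf_iff)
  next
    case True
    then have nonempty: "set_pmf Q \<inter> {y. butlast y = l} \<noteq> {}" using cons by auto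
    have P: "measure Q {y. butlast y = l} = pmf P l" by (simp add: pmf_map vimage_def flip: cons)
    have "pmf (\<kappa> l) a = measure (cond_pmf Q {y. butlast y = l}) (last -` {a})"
      by (simp add: \<kappa>_def pmf_map)
    also have "\<dots> = measure (cond_pmf Q {y. butlast y = l}) {l @ [a]}"
    proof (rule measure_prob_cong_0)
      fix y assume y: "y \<in> last -` {a} - {l @ [a]}"
      have "y \<notin> set_pmf (cond_pmf Q {y. butlast y = l})"
      proof
        assume "y \<in> set_pmf (cond_pmf Q {y. butlast y = l})"
        then have "y \<in> set_pmf Q" "butlast y = l" using nonempty by auto
        moreover have "y \<noteq> []" using \<open>y \<in> set_pmf Q\<close> ne by metis
        ultimately show False using y append_butlast_last_id[of y] by auto
      qed
      then show "pmf (cond_pmf Q {y. butlast y = l}) y = 0" by (simp add: set_pmf_iff)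
    qed auto
    also have "\<dots> = pmf Q (l @ [a]) / pmf P l"
      using nonempty by (simp add: measure_pmf_single pmf_cond P)
    finally show ?thesis using True by (simp add: set_pmf_iff)
  qed
  then show ?thesis by blast
qed

text \<open>
  The theorem of Ionescu Tulcea, applied to the conditional laws of the next entry. These kernels
  take countably many values besides a default, which makes them measurable on products of discrete
  spaces of any cardinality.
\<close>

lemma pmf_projective_limit:
  fixes P :: "nat \<Rightarrow> 'a list pmf"
  assumes len: "\<And>n l. l \<in> set_pmf (P n) \<Longrightarrow> length l = n"
    and cons: "\<And>n. map_pmf butlast (P (Suc n)) = P n"
  shows "\<exists>\<mu>. prob_space \<mu> \<and> sets \<mu> = sets (PiM UNIV (\<lambda>_::nat. count_space UNIV)) \<and>
    (\<forall>n s. measure \<mu> {x \<in> space \<mu>. map x [0..<n] = s} = pmf (P n) s)"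
proof -
  have "\<forall>n. \<exists>\<kappa>. \<forall>l a. pmf (P (Suc n)) (l @ [a]) = pmf (P n) l * pmf (\<kappa> l) a"
  proof
    fix n
    have "[] \<notin> set_pmf (P (Suc n))" using len[of "[]" "Suc n"] by auto
    then show "\<exists>\<kappa>. \<forall>l a. pmf (P (Suc n)) (l @ [a]) = pmf (P n) l * pmf (\<kappa> l) a"
      by (rule pmf_extension_step[OF cons])
  qed
  then obtain \<kappa> :: "nat \<Rightarrow> 'a list \<Rightarrow> 'a pmf" where
    \<kappa>: "\<And>n l a. pmf (P (Suc n)) (l @ [a]) = pmf (P n) l * pmf (\<kappa> n l) a" by metis
  define M :: "nat \<Rightarrow> 'a measure" where "M = (\<lambda>_. count_space UNIV)"
  \<comment> \<open>The default outside of the support makes the range of the kernel countable, hence \<open>K\<close> measurable.\<close>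
  define K where "K n x = measure_pmf (if map x [0..<n] \<in> set_pmf (P n) then \<kappa> n (map x [0..<n])
      else return_pmf undefined)" for n x
  have cyl: "{x \<in> space (PiM I M). map x [0..<n] = l} \<in> sets (PiM I M)" if "{0..<n} \<subseteq> I" for I n l
  proof (cases "length l = n")
    case True
    have "map x [0..<n] = l \<longleftrightarrow> (\<forall>i\<in>{0..<n}. x i \<in> {l ! i})" for x :: "nat \<Rightarrow> 'a"
      using True by (subst list_eq_iff_nth_eq) auto
    then have "{x \<in> space (PiM I M). map x [0..<n] = l} = {x \<in> space (PiM I M). \<forall>i\<in>{0..<n}. x i \<in> {l ! i}}"
      by simp
    also have "\<dots> \<in> sets (PiM I M)"
      using that by (intro sets.sets_Collect_finite_All sets_Collect_single) (auto simp: M_def)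
    finally show ?thesis .
  next
    case False
    then have "{x \<in> space (PiM I M). map x [0..<n] = l} = {}" by auto
    then show ?thesis by (simp only: sets.empty_sets)
  qed
  have K_meas: "K n \<in> measurable (PiM {0..<n} M) (subprob_algebra (M n))" for n
  proof -
    define I where "I = insert None (Some ` set_pmf (P n))"
    define g where "g x = (if map x [0..<n] \<in> set_pmf (P n) then Some (map x [0..<n]) else None)" for x :: "nat \<Rightarrow> 'a"
    have I: "countable I" unfolding I_def by simp
    let ?N = "PiM {0..<n} M"
    have pre: "g -` {Some l} \<inter> space ?N \<in> sets ?N" if "l \<in> set_pmf (P n)" for l
    proof -
      have "g -` {Some l} \<inter> space ?N = {x \<in> space ?N. map x [0..<n] = l}" using that by (auto simp: g_def split: if_splits)
      then show ?thesis using cyl[of n "{0..<n}" l] by simp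
    qed
    have "g -` {None} \<inter> space ?N = space ?N - (\<Union>l\<in>set_pmf (P n). g -` {Some l} \<inter> space ?N)"
      by (auto simp: g_def) blast
    also have "\<dots> \<in> sets ?N" using pre by (intro sets.Diff sets.countable_UN') auto
    finally have "g \<in> measurable ?N (count_space I)"
      using pre unfolding measurable_count_space_eq_countable[OF I] by (auto simp: I_def g_def)
    moreover have "(\<lambda>x. measure_pmf (case opt of Some l \<Rightarrow> \<kappa> n l | None \<Rightarrow> return_pmf undefined))
        \<in> measurable ?N (subprob_algebra (M n))" for opt
      unfolding M_def by (rule measurable_const[OF measure_pmf_in_subprob_algebra])
    ultimately have "(\<lambda>x. measure_pmf (case g x of Some l \<Rightarrow> \<kappa> n l | None \<Rightarrow> return_pmf undefined))
        \<in> measurable ?N (subprob_algebra (M n))"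
      by (intro measurable_compose_countable'[where g = g and I = I and
          f = "\<lambda>opt x. measure_pmf (case opt of Some l \<Rightarrow> \<kappa> n l | None \<Rightarrow> return_pmf undefined)", OF _ _ I])
    also have "(\<lambda>x. measure_pmf (case g x of Some l \<Rightarrow> \<kappa> n l | None \<Rightarrow> return_pmf undefined)) = K n"
      by (auto simp: K_def g_def fun_eq_iff)
    finally show ?thesis .
  qed
  interpret IT: Ionescu_Tulcea K M
    by (rule Ionescu_Tulcea.intro) (rule K_meas, simp only: K_def prob_space_measure_pmf)
  let ?u = "\<lambda>_. undefined"
  have sp: "?u \<in> space (PiM {0..<0} M)" by (simp add: space_PiM)
  have C: "emeasure (IT.C 0 n ?u) {x \<in> space (PiM {0..<n} M). map x [0..<n] = l} = ennreal (pmf (P n) l)" for n l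
  proof (induction n arbitrary: l)
    case 0
    have "set_pmf (P 0) \<subseteq> {[]}" using len[of _ 0] by auto
    then have "P 0 = return_pmf []" by (simp add: set_pmf_subset_singleton)
    moreover have "{x \<in> space (PiM {0..<0} M). map x [0..<0] = l} \<in> sets (PiM {0..<0} M)" by (rule cyl) simp
    ultimately show ?case using sp by (auto simp: indicator_def)
  next
    case (Suc n)
    let ?A = "{x \<in> space (PiM {0..<Suc n} M). map x [0..<Suc n] = l}"
    have A: "?A \<in> sets (PiM {0..<Suc n} M)" by (rule cyl) simp
    show ?case
    proof (cases l rule: rev_cases)
      case Nil
      have "[] \<notin> set_pmf (P (Suc n))" using len[of "[]" "Suc n"] by auto
      moreover have "?A = {}" using Nil by auto
      ultimately show ?thesis using Nil by (simp add: set_pmf_iff del: upt_Suc IT.C.simps)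
    next
      case (snoc l' a)
      let ?B = "{x \<in> space (PiM {0..<n} M). map x [0..<n] = l'}"
      have B: "?B \<in> sets (PiM {0..<n} M)" by (rule cyl) simp
      have eP: "emeasure (IT.eP n x) ?A = ennreal (pmf (\<kappa> n l') a) * indicator ?B x"
        if x: "x \<in> space (PiM {0..<n} M)" and l': "l' \<in> set_pmf (P n)" for x
      proof -
        have upd: "map (x(n := b)) [0..<n] = map x [0..<n]" for b by auto
        have vim: "(\<lambda>b. x(n := b)) -` ?A \<inter> space (M n) = (if map x [0..<n] = l' then {a} else {})"
          using x by (auto simp: snoc upd M_def space_PiM PiE_iff extensional_def)
        show ?thesis
          unfolding IT.emeasure_eP[OF x A] vim K_def
          using x l' by (simp add: emeasure_pmf_single indicator_def)
      qed
      have "emeasure (IT.C 0 (Suc n) ?u) ?A = (\<integral>\<^sup>+x. emeasure (IT.eP n x) ?A \<partial>IT.C 0 n ?u)"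
      proof -
        have "IT.eP n \<in> measurable (IT.C 0 n ?u) (subprob_algebra (PiM {0..<Suc n} M))"
          using IT.measurable_eP[of n] IT.sets_C[OF sp, of n] by (simp cong: measurable_cong_sets)
        moreover have "space (IT.C 0 n ?u) \<noteq> {}"
          by (rule prob_space.not_empty[OF IT.prob_space_C[OF sp]])
        ultimately show ?thesis
          unfolding IT.C.simps add_0 using A by (intro emeasure_bind)
      qed
      also have "\<dots> = ennreal (pmf (P (Suc n)) l)"
      proof (cases "l' \<in> set_pmf (P n)")
        case True
        have "(\<integral>\<^sup>+x. emeasure (IT.eP n x) ?A \<partial>IT.C 0 n ?u) =
            (\<integral>\<^sup>+x. ennreal (pmf (\<kappa> n l') a) * indicator ?B x \<partial>IT.C 0 n ?u)"
          using eP[OF _ True] IT.space_C[OF sp, of n] by (intro nn_integral_cong) auto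
        also have "\<dots> = ennreal (pmf (\<kappa> n l') a) * ennreal (pmf (P n) l')"
          using B IT.sets_C[OF sp, of n] Suc.IH[of l'] by (subst nn_integral_cmult_indicator) auto
        finally show ?thesis by (simp add: snoc \<kappa> ennreal_mult mult.commute)
      next
        case False
        have null: "emeasure (IT.C 0 n ?u) ?B = 0" using Suc.IH[of l'] False by (simp add: set_pmf_iff)
        have "(\<integral>\<^sup>+x. emeasure (IT.eP n x) ?A \<partial>IT.C 0 n ?u) \<le> (\<integral>\<^sup>+x. indicator ?B x \<partial>IT.C 0 n ?u)"
        proof (rule nn_integral_mono)
          fix x assume "x \<in> space (IT.C 0 n ?u)"
          then have x: "x \<in> space (PiM {0..<n} M)" using IT.space_C[OF sp, of n] by simp
          interpret e: prob_space "IT.eP n x" by (rule IT.prob_space_eP[OF x])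
          show "emeasure (IT.eP n x) ?A \<le> indicator ?B x"
          proof (cases "map x [0..<n] = l'")
            case True
            then show ?thesis using x e.measure_le_1 by (simp add: indicator_def)
          next
            case False
            have upd: "map (x(n := b)) [0..<n] = map x [0..<n]" for b by auto
            have vim: "(\<lambda>b. x(n := b)) -` ?A \<inter> space (M n) = {}" using False by (auto simp: snoc upd)
            show ?thesis unfolding IT.emeasure_eP[OF x A] vim by simp
          qed
        qed
        also have "\<dots> = 0" using B IT.sets_C[OF sp, of n] null by simp
        finally show ?thesis using False by (simp add: snoc \<kappa> set_pmf_iff)
      qed
      finally show ?thesis .
    qed
  qed
  have sets: "sets IT.PF.lim = sets (PiM UNIV M)" by (rule IT.PF.sets_lim)
  have cyls: "emeasure IT.PF.lim {x \<in> space IT.PF.lim. map x [0..<n] = s} = ennreal (pmf (P n) s)" for n s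
  proof -
    let ?X = "{x \<in> space (PiM {0..<n} M). map x [0..<n] = s}"
    have X: "?X \<in> sets (PiM {0..<n} M)" by (rule cyl) simp
    have r: "map (restrict x {0..<n}) [0..<n] = map x [0..<n]" for x :: "nat \<Rightarrow> 'a" by auto
    have "{x \<in> space IT.PF.lim. map x [0..<n] = s} = IT.PF.emb UNIV {0..<n} ?X"
    proof -
      have "space IT.PF.lim = UNIV" unfolding IT.PF.space_lim by (simp add: space_PiM M_def)
      moreover have "space (PiM {0..<n} M) = extensional {0..<n}" by (simp add: space_PiM M_def PiE_def)
      moreover have "space (PiM UNIV M) = UNIV" by (simp add: space_PiM M_def)
      moreover have "space (M i) = UNIV" for i by (simp add: M_def)
      ultimately show ?thesis by (auto simp: prod_emb_def r)
    qed
    then have "emeasure IT.PF.lim {x \<in> space IT.PF.lim. map x [0..<n] = s} = emeasure (IT.CI {0..<n}) ?X"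
      using IT.lim[OF _ X] by simp
    also have "\<dots> = emeasure (IT.C 0 n ?u) (IT.PF.emb {0..<n} {0..<n} ?X)"
      by (rule IT.emeasure_CI[OF _ X]) simp
    also have "IT.PF.emb {0..<n} {0..<n} ?X = ?X"
      by (rule prod_emb_id) (auto simp: space_PiM)
    also have "emeasure (IT.C 0 n ?u) ?X = ennreal (pmf (P n) s)" by (rule C)
    finally show ?thesis .
  qed
  have "set_pmf (P 0) \<subseteq> {[]}" using len[of _ 0] by auto
  then have "P 0 = return_pmf []" by (simp add: set_pmf_subset_singleton)
  then have "prob_space IT.PF.lim" using cyls[of 0 "[]"] by (intro prob_spaceI) simp
  moreover have "measure IT.PF.lim {x \<in> space IT.PF.lim. map x [0..<n] = s} = pmf (P n) s" for n s
    unfolding measure_def cyls by simp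
  ultimately show ?thesis using sets unfolding M_def by blast
qed

section \<open>From the driving sequence to the tree chain\<close>

definition grow :: "nat list \<Rightarrow> nat \<times> nat \<Rightarrow> nat list" where
  "grow T y = T @ [(par T ^^ snd y) (fst y)]"

text \<open>
  The law of the first \<open>n\<close> pairs of the driving sequence, as a list.
\<close>

primrec history :: "nat pmf \<Rightarrow> nat \<Rightarrow> (nat \<times> nat) list pmf" where
  "history p 0 = return_pmf []"
| "history p (Suc n) =
     history p n \<bind> (\<lambda>l. map_pmf (\<lambda>y. l @ [y]) (pair_pmf (pmf_of_set {0..n}) p))"

lemma set_history:
  "l \<in> set_pmf (history p n) \<Longrightarrow> length l = n \<and> (\<forall>i<n. fst (l ! i) \<le> i)"
proof (induction n arbitrary: l)
  case (Suc n)
  then obtain l' y where "l' \<in> set_pmf (history p n)" "l = l' @ [y]" "fst y \<le> n"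
    by auto
  then show ?case using Suc.IH[of l'] by (auto simp: nth_append less_Suc_eq)
qed simp

lemma length_foldl_grow: "length (foldl grow T l) = length T + length l"
  by (induction l arbitrary: T) (auto simp: grow_def)

lemma chain_eq_history: "chain p n = map_pmf (foldl grow []) (history p n)"
proof (induction n)
  case (Suc n)
  have "chain p (Suc n) = history p n \<bind> (\<lambda>l. map_pmf (\<lambda>t. foldl grow [] l @ [t]) (target p (foldl grow [] l)))"
    by (simp add: Suc bind_map_pmf)
  also have "\<dots> = history p n \<bind> (\<lambda>l. map_pmf (\<lambda>y. grow (foldl grow [] l) y) (pair_pmf (pmf_of_set {0..n}) p))"
  proof (intro bind_pmf_cong refl)
    fix l assume "l \<in> set_pmf (history p n)"
    then have "length (foldl grow [] l) = n" using set_history length_foldl_grow[of "[]" l] by simp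
    then show "map_pmf (\<lambda>t. foldl grow [] l @ [t]) (target p (foldl grow [] l)) =
        map_pmf (\<lambda>y. grow (foldl grow [] l) y) (pair_pmf (pmf_of_set {0..n}) p)"
      by (simp add: target_def pair_pmf_def grow_def map_pmf_def bind_assoc_pmf bind_return_pmf)
  qed
  also have "\<dots> = map_pmf (foldl grow []) (history p (Suc n))"
    by (simp add: map_bind_pmf map_pmf_comp)
  finally show ?case .
qed simp

lemma attach_ctree: "attach (ctree T) (Suc (length T)) t = ctree (T @ [t])"
  unfolding attach_def by (auto simp: ctree_def par_def nth_append fun_eq_iff le_Suc_eq)

text \<open>
  The condition on the chosen vertices matters: a choice outside of the tree could create a cycle
  in the parent function. It holds almost surely.
\<close>

lemma random_tree_eq_ctree:
  assumes "\<forall>i<n. fst (w i) \<le> i"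
  shows "random_tree n w = ctree (foldl grow [] (map w [0..<n])) \<and> rec_code (foldl grow [] (map w [0..<n]))"
  using assms
proof (induction n)
  case 0
  have "par [] = (\<lambda>_. 0)" by (auto simp: par_def)
  then show ?case by (simp add: ctree_def)
next
  case (Suc n)
  let ?T = "foldl grow [] (map w [0..<n])"
  let ?t = "(par ?T ^^ snd (w n)) (fst (w n))"
  have IH: "random_tree n w = ctree ?T" "rec_code ?T" using Suc by auto
  have len: "length ?T = n" using length_foldl_grow[of "[]"] by simp
  have grow: "foldl grow [] (map w [0..<Suc n]) = ?T @ [?t]" by (simp add: grow_def)
  have "(par ?T ^^ min (snd (w n)) (level ?T (fst (w n)))) (fst (w n)) = ?t"
  proof (cases "snd (w n) \<le> level ?T (fst (w n))")
    case False
    then have "?t = 0" "(par ?T ^^ level ?T (fst (w n))) (fst (w n)) = 0"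
      by (intro par_iter_eq_0_iff[OF IH(2), THEN iffD2]; simp)+
    then show ?thesis using False by simp
  qed simp
  then have "random_tree (Suc n) w = attach (ctree ?T) (Suc (length ?T)) ?t"
    by (simp add: IH(1) len)
  moreover have "?t \<le> length ?T" using par_iter_le[OF IH(2), of "snd (w n)" "fst (w n)"] Suc.prems len by force
  ultimately show ?case using IH(2) grow attach_ctree by simp
qed

lemma random_tree_cong: "(\<And>i. i < n \<Longrightarrow> w i = w' i) \<Longrightarrow> random_tree n w = random_tree n w'"
  by (induction n) auto

lemma pmf_history_snoc:
  "pmf (history p (Suc n)) (l @ [y]) = pmf (history p n) l * pmf (pair_pmf (pmf_of_set {0..n}) p) y"
proof -
  let ?D = "pair_pmf (pmf_of_set {0..n}) p"
  have "pmf (map_pmf (\<lambda>y. l' @ [y]) ?D) (l @ [y]) = indicator {l} l' * pmf ?D y" for l'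
  proof (cases "l' = l")
    case True
    then show ?thesis using pmf_map_inj'[of "\<lambda>y. l @ [y]" ?D y] by (simp add: inj_on_def)
  next
    case False
    then have "pmf (map_pmf (\<lambda>y. l' @ [y]) ?D) (l @ [y]) = 0"
      unfolding pmf_eq_0_set_pmf by auto
    then show ?thesis using False by simp
  qed
  then show ?thesis by (simp add: pmf_bind measure_pmf_single)
qed

lemma pmf_history:
  "length l = n \<Longrightarrow> pmf (history p n) l = (\<Prod>i<n. pmf (pair_pmf (pmf_of_set {0..i}) p) (l ! i))"
proof (induction n arbitrary: l)
  case (Suc n)
  then obtain l' y where l: "l = l' @ [y]" "length l' = n" by (cases l rule: rev_cases) auto
  then show ?case using Suc.IH[of l'] unfolding l(1) pmf_history_snoc by (simp add: nth_append)
qed simp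

lemma space_driving [simp]: "space (driving p) = UNIV"
  by (simp add: driving_def space_PiM)

lemma cylinder_driving:
  shows "{w. map w [0..<n] = l} \<in> sets (driving p)"
    and "emeasure (driving p) {w. map w [0..<n] = l} = ennreal (pmf (history p n) l)"
proof -
  let ?D = "\<lambda>n. measure_pmf (pair_pmf (pmf_of_set {0..n}) p)"
  interpret product_prob_space ?D UNIV
    by (rule product_prob_spaceI) (rule prob_space_measure_pmf)
  have *: "{w. map w [0..<n] = l} \<in> sets (driving p) \<and>
      emeasure (driving p) {w. map w [0..<n] = l} = ennreal (pmf (history p n) l)"
  proof (cases "length l = n")
    case True
    have "map w [0..<n] = l \<longleftrightarrow> (\<forall>i\<in>{..<n}. w i \<in> {l ! i})" for w :: "nat \<Rightarrow> nat \<times> nat"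
      using True by (subst list_eq_iff_nth_eq) auto
    then have eq: "{w. map w [0..<n] = l} = {w \<in> space (PiM UNIV ?D). \<forall>i\<in>{..<n}. w i \<in> {l ! i}}"
      by (simp add: space_PiM)
    have "emeasure (PiM UNIV ?D) {w \<in> space (PiM UNIV ?D). \<forall>i\<in>{..<n}. w i \<in> {l ! i}} =
        (\<Prod>i\<in>{..<n}. emeasure (?D i) {l ! i})"
      by (rule emeasure_PiM_Collect) auto
    also have "\<dots> = ennreal (pmf (history p n) l)"
      using True by (simp add: emeasure_pmf_single prod_ennreal pmf_history)
    finally have "emeasure (driving p) {w. map w [0..<n] = l} = ennreal (pmf (history p n) l)"
      unfolding driving_def eq .
    moreover have "{w. map w [0..<n] = l} \<in> sets (driving p)"
      unfolding driving_def eq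
      by (intro sets.sets_Collect_finite_All sets_Collect_single) auto
    ultimately show ?thesis by simp
  next
    case False
    then have e: "{w. map w [0..<n] = l} = {}" by auto
    have "l \<notin> set_pmf (history p n)" using False set_history by blast
    then show ?thesis unfolding e by (simp add: set_pmf_iff)
  qed
  show "{w. map w [0..<n] = l} \<in> sets (driving p)" using * by blast
  show "emeasure (driving p) {w. map w [0..<n] = l} = ennreal (pmf (history p n) l)" using * by blast
qed

lemma distr_driving:
  shows "(\<lambda>w. map w [0..<n]) \<in> measurable (driving p) (count_space UNIV)"
    and "distr (driving p) (count_space UNIV) (\<lambda>w. map w [0..<n]) = measure_pmf (history p n)"
proof -
  have vim: "(\<lambda>w. map w [0..<n]) -` {l} = {w. map w [0..<n] = l}" for l :: "(nat \<times> nat) list" by auto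
  show m: "(\<lambda>w. map w [0..<n]) \<in> measurable (driving p) (count_space UNIV)"
    unfolding measurable_count_space_eq2_countable by (simp add: vim cylinder_driving(1))
  show "distr (driving p) (count_space UNIV) (\<lambda>w. map w [0..<n]) = measure_pmf (history p n)"
  proof (rule measure_eqI_countable[of _ UNIV])
    fix l
    show "emeasure (distr (driving p) (count_space UNIV) (\<lambda>w. map w [0..<n])) {l} =
        emeasure (measure_pmf (history p n)) {l}"
      by (subst emeasure_distr[OF m]) (simp_all add: vim cylinder_driving(2) emeasure_pmf_single)
  qed auto
qed

text \<open>
  From here on the random trees can be studied through the laws \<open>chain p n\<close>, which have finite
  support.
\<close>

theorem measure_random_tree:
  "measure (driving p) {w \<in> space (driving p). P (random_tree n w)} =
   measure_pmf.prob (chain p n) {T. P (ctree T)}"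
proof -
  have "random_tree n w = random_tree n ((!) (map w [0..<n]))" for w
    by (rule random_tree_cong) simp
  then have "{w \<in> space (driving p). P (random_tree n w)} =
      (\<lambda>w. map w [0..<n]) -` {l. P (random_tree n ((!) l))} \<inter> space (driving p)"
    by (simp only: space_driving) auto
  then have "measure (driving p) {w \<in> space (driving p). P (random_tree n w)} =
      measure (distr (driving p) (count_space UNIV) (\<lambda>w. map w [0..<n])) {l. P (random_tree n ((!) l))}"
    by (simp only: measure_distr[OF distr_driving(1)] sets_count_space Pow_UNIV UNIV_I)
  also have "\<dots> = measure_pmf.prob (history p n) {l. P (random_tree n ((!) l))}"
    by (simp only: distr_driving(2))
  also have "\<dots> = measure_pmf.prob (history p n) {l. P (ctree (foldl grow [] l))}"
  proof (rule measure_prob_cong_0)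
    have eq: "random_tree n ((!) l) = ctree (foldl grow [] l)" if "l \<in> set_pmf (history p n)" for l
    proof -
      have l: "length l = n" "\<forall>i<n. fst (l ! i) \<le> i" using set_history[OF that] by auto
      have "map ((!) l) [0..<n] = l" using l(1) map_nth[of l] by simp
      then show ?thesis using random_tree_eq_ctree[OF l(2)] by simp
    qed
    show "pmf (history p n) l = 0"
      if "l \<in> {l. P (random_tree n ((!) l))} - {l. P (ctree (foldl grow [] l))}" for l
      using eq[of l] that by (subst pmf_eq_0_set_pmf) auto
    show "pmf (history p n) l = 0"
      if "l \<in> {l. P (ctree (foldl grow [] l))} - {l. P (random_tree n ((!) l))}" for l
      using eq[of l] that by (subst pmf_eq_0_set_pmf) auto
  qed
  also have "\<dots> = measure_pmf.prob (chain p n) {T. P (ctree T)}"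
    by (simp add: chain_eq_history vimage_def)
  finally show ?thesis .
qed

section \<open>Convergence of the attachment model\<close>

text \<open>
  Markov's inequality.
\<close>

lemma L1_imp_in_prob:
  fixes X :: "nat list \<Rightarrow> real"
  assumes "(\<lambda>n. measure_pmf.expectation (chain p n) (\<lambda>T. \<bar>X T\<bar>)) \<longlonglongrightarrow> 0" "0 < e"
  shows "(\<lambda>n. measure_pmf.prob (chain p n) {T. \<bar>X T\<bar> > e}) \<longlonglongrightarrow> 0"
proof (rule tendsto_sandwich[OF _ _ tendsto_const])
  have "measure_pmf.prob (chain p n) {T. \<bar>X T\<bar> > e} \<le> measure_pmf.expectation (chain p n) (\<lambda>T. \<bar>X T\<bar>) / e" for n
  proof -
    have "measure_pmf.prob (chain p n) {T. \<bar>X T\<bar> > e} =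
        measure_pmf.expectation (chain p n) (indicat_real {T. \<bar>X T\<bar> > e})" by simp
    also have "\<dots> \<le> measure_pmf.expectation (chain p n) (\<lambda>T. \<bar>X T\<bar> / e)"
      using assms(2) by (intro integral_mono) (auto simp: indicator_def)
    finally show ?thesis by simp
  qed
  then show "\<forall>\<^sub>F n in sequentially. measure_pmf.prob (chain p n) {T. \<bar>X T\<bar> > e} \<le>
      measure_pmf.expectation (chain p n) (\<lambda>T. \<bar>X T\<bar>) / e" by simp
  show "(\<lambda>n. measure_pmf.expectation (chain p n) (\<lambda>T. \<bar>X T\<bar>) / e) \<longlonglongrightarrow> 0"
    using tendsto_divide_zero[OF assms(1)] .
qed simp

lemma fringe_law_size_pos:
  assumes "full_mass p k = 1" "s \<in> set_pmf (fringe_law p k)" "t \<in> set s"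
  shows "0 < tree_size t"
proof -
  obtain ps x where *: "(ps, x) \<in> marked_codes k" "s = ext_fringe k x (ctree ps)"
    using assms set_marked_law[OF assms(1)] by (auto simp: fringe_law_def)
  then obtain i where "t = fringe (ctree ps) x i" "i \<le> k"
    using assms(3) by (auto simp: ext_fringe_def less_Suc_eq_le simp del: upt_Suc)
  then show ?thesis using * tree_size_fringe_pos[of ps x i] by (auto simp: marked_codes_def)
qed

text \<open>
  The law \<open>Q\<close> is carried by a countable set, so countably many cylinders carry \<open>\<mu>\<close>.
\<close>

lemma AE_cylinder_support:
  assumes "prob_space \<mu>" and eq: "\<And>s. measure \<mu> {x \<in> space \<mu>. map x [0..<n] = s} = pmf Q s"
  shows "AE x in \<mu>. map x [0..<n] \<in> set_pmf Q"
proof -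
  interpret prob_space \<mu> by fact
  let ?X = "\<lambda>s. {x \<in> space \<mu>. map x [0..<n] = s}"
  \<comment> \<open>A cylinder of positive measure is measurable, since non-measurable sets have measure \<open>0\<close>.\<close>
  have X: "?X s \<in> sets \<mu>" if "s \<in> set_pmf Q" for s
  proof (rule ccontr)
    assume "?X s \<notin> sets \<mu>"
    then have "measure \<mu> (?X s) = 0" by (rule measure_notin_sets)
    then show False using eq that by (simp add: set_pmf_iff)
  qed
  have "emeasure \<mu> (\<Union>s\<in>set_pmf Q. ?X s) = (\<integral>\<^sup>+s. emeasure \<mu> (?X s) \<partial>count_space (set_pmf Q))"
    using X by (intro emeasure_UN_countable) (auto simp: disjoint_family_on_def)
  also have "\<dots> = (\<integral>\<^sup>+s. ennreal (pmf Q s) \<partial>count_space (set_pmf Q))"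
    by (simp add: emeasure_eq_measure eq)
  also have "\<dots> = 1" by (simp add: nn_integral_pmf measure_pmf.emeasure_eq_measure measure_pmf.prob_eq_1 AE_measure_pmf)
  finally have "prob (\<Union>s\<in>set_pmf Q. ?X s) = 1" by (simp add: emeasure_eq_measure)
  then have "AE x in \<mu>. x \<in> (\<Union>s\<in>set_pmf Q. ?X s)" by (rule AE_prob_1)
  then show ?thesis by eventually_elim auto
qed

text \<open>
  The law of the limiting sin-tree is the projective limit of the laws \<open>fringe_law p k\<close>. For the
  height, any fringe of depth \<open>K\<close> with positive limiting frequency occurs somewhere with
  probability tending to \<open>1\<close>, and it requires a vertex of depth \<open>K\<close>.
\<close>

theorem corollary3p4:
  fixes p :: "nat pmf"
  assumes mean: "(\<integral>\<^sup>+ k. of_nat k \<partial>measure_pmf p) \<le> 1"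
    and nondegenerate: "p \<noteq> return_pmf 1"
  shows "(\<exists>\<mu>. random_sin_tree \<mu> \<and> converges_ext_fringe (driving p) random_tree \<mu>) \<and>
         diverges_in_prob (driving p) (\<lambda>n w. tree_height (random_tree n w))"
proof
  note full = full_mass_eq_1[OF mean nondegenerate]
  have conv: "(\<lambda>n. measure_pmf.prob (chain p n) {T. \<bar>fringe_proportion k s (ctree T) - pmf (fringe_law p k) s\<bar> > e})
      \<longlonglongrightarrow> 0" if "empty_tree \<notin> set s" "0 < e" for k s e
    by (rule L1_imp_in_prob[OF fringe_proportion_limit[OF full that(1)] that(2)])
  \<comment> \<open>Shifted by one, since a fringe of depth \<open>k\<close> is a list of length \<open>k + 1\<close>.\<close>
  define P where "P n = (case n of 0 \<Rightarrow> return_pmf [] | Suc k \<Rightarrow> fringe_law p k)" for n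
  have len: "length l = n" if "l \<in> set_pmf (P n)" for n l
    using that set_fringe_law(1)[OF full] by (auto simp: P_def split: nat.splits)
  have cons: "map_pmf butlast (P (Suc n)) = P n" for n
  proof (cases n)
    case 0
    have "map_pmf butlast (fringe_law p 0) = map_pmf (\<lambda>_. []) (fringe_law p 0)"
    proof (intro map_pmf_cong refl)
      fix l assume "l \<in> set_pmf (fringe_law p 0)"
      then have "length l = Suc 0" by (rule set_fringe_law(1)[OF full])
      then show "butlast l = []" by (cases l) auto
    qed
    then show ?thesis using 0 by (simp add: P_def)
  next
    case (Suc k)
    then show ?thesis using fringe_law_consistent[OF full, of k] by (simp add: P_def)
  qed
  from pmf_projective_limit[of P, OF len cons]
  obtain \<mu> :: "(nat \<Rightarrow> rtree) measure" where \<mu>: "prob_space \<mu>"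
      "sets \<mu> = sets (PiM UNIV (\<lambda>_. count_space UNIV))"
      "\<And>n s. measure \<mu> {x \<in> space \<mu>. map x [0..<n] = s} = pmf (P n) s"
    by blast
  have "AE x in \<mu>. \<forall>i. tree_size (x i) \<ge> 1"
    unfolding AE_all_countable
  proof
    fix i
    have "AE x in \<mu>. map x [0..<Suc i] \<in> set_pmf (P (Suc i))"
      by (rule AE_cylinder_support[OF \<mu>(1,3)])
    then show "AE x in \<mu>. tree_size (x i) \<ge> 1"
    proof eventually_elim
      case (elim x)
      then have "map x [0..<Suc i] \<in> set_pmf (fringe_law p i)" by (simp add: P_def)
      then have "0 < tree_size (x i)" by (rule fringe_law_size_pos[OF full]) auto
      then show ?case by simp
    qed
  qed
  then have "random_sin_tree \<mu>" using \<mu> by (simp add: random_sin_tree_def is_sin_tree_def)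
  moreover have "converges_ext_fringe (driving p) random_tree \<mu>"
    unfolding converges_ext_fringe_def
  proof (intro conjI allI impI)
    show "diverges_in_prob (driving p) (\<lambda>n w. card (verts (random_tree n w)))"
      unfolding diverges_in_prob_def
    proof
      fix K
      have "measure (driving p) {w \<in> space (driving p). K \<le> card (verts (random_tree n w))} = 1" if "K \<le> n" for n
      proof -
        have "AE T in chain p n. K \<le> card (verts (ctree T))"
          using set_chain[of p n] that by (auto simp: AE_measure_pmf_iff codes_def)
        then have "measure_pmf.prob (chain p n) {T. K \<le> card (verts (ctree T))} = 1"
          by (subst measure_pmf.prob_eq_1) auto
        then show ?thesis by (simp only: measure_random_tree[where P = "\<lambda>t. K \<le> card (verts t)"])
      qed
      then show "(\<lambda>n. measure (driving p) {w \<in> space (driving p). K \<le> card (verts (random_tree n w))}) \<longlonglongrightarrow> 1"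
        by (intro tendsto_eventually eventually_mono[OF eventually_ge_at_top[of K]])
    qed
  next
    fix k s assume s: "length s = Suc k \<and> empty_tree \<notin> set s"
    have "measure \<mu> {x \<in> space \<mu>. map x [0..<Suc k] = s} = pmf (fringe_law p k) s"
      unfolding \<mu>(3) by (simp add: P_def)
    then show "converges_in_prob (driving p) (\<lambda>n w. fringe_proportion k s (random_tree n w))
        (measure \<mu> {x \<in> space \<mu>. map x [0..<Suc k] = s})"
      using conv s unfolding converges_in_prob_def
      by (simp only: measure_random_tree[where P = "\<lambda>t. \<bar>fringe_proportion k s t - c\<bar> > e" for c e]) blast
  qed
  ultimately show "\<exists>\<mu>. random_sin_tree \<mu> \<and> converges_ext_fringe (driving p) random_tree \<mu>" by blast
  show "diverges_in_prob (driving p) (\<lambda>n w. tree_height (random_tree n w))"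
    unfolding diverges_in_prob_def
  proof
    fix K
    obtain s where s: "s \<in> set_pmf (fringe_law p K)" using set_pmf_not_empty[of "fringe_law p K"] by blast
    define c where "c = pmf (fringe_law p K) s"
    have c: "0 < c" using s by (simp add: c_def pmf_positive)
    have ne: "empty_tree \<notin> set s" by (rule set_fringe_law(2)[OF full s])
    \<comment> \<open>Where the proportion of \<open>s\<close> is within \<open>c / 2\<close> of its limit \<open>c\<close>, it is not \<open>0\<close>.\<close>
    let ?bad = "{T. \<bar>fringe_proportion K s (ctree T) - c\<bar> > c / 2}"
    have lower: "1 - measure_pmf.prob (chain p n) ?bad \<le>
        measure_pmf.prob (chain p n) {T. K \<le> tree_height (ctree T)}" for n
    proof -
      have "1 - measure_pmf.prob (chain p n) ?bad = measure_pmf.prob (chain p n) (- ?bad)"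
        using measure_pmf.prob_compl[of ?bad "chain p n"] by (simp add: Compl_eq_Diff_UNIV)
      also have "\<dots> \<le> measure_pmf.prob (chain p n) {T. K \<le> tree_height (ctree T)}"
      proof (rule measure_pmf.finite_measure_mono_AE)
        show "AE T in chain p n. T \<in> - ?bad \<longrightarrow> T \<in> {T. K \<le> tree_height (ctree T)}"
        proof (intro AE_pmfI impI)
          fix T assume "T \<in> set_pmf (chain p n)" and good: "T \<in> - ?bad"
          then have T: "rec_code T" using set_chain[of p n] by (auto simp: codes_def)
          have "fringe_proportion K s (ctree T) \<noteq> 0" using good c by auto
          then have "{v \<in> verts (ctree T). ext_fringe K v (ctree T) = s} \<noteq> {}"
            unfolding fringe_proportion_def by (metis card.empty div_0 of_nat_0)
          then obtain v where v: "v \<le> length T" "ext_fringe K v (ctree T) = s" by auto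
          then have "K \<le> level T v" using ext_fringe_nonempty_iff[OF T v(1), of K] ne by simp
          also have "level T v \<le> tree_height (ctree T)"
            unfolding tree_height_def using v by (intro Max_ge) auto
          finally show "T \<in> {T. K \<le> tree_height (ctree T)}" by simp
        qed
      qed simp
      finally show ?thesis .
    qed
    have "(\<lambda>n. measure_pmf.prob (chain p n) {T. K \<le> tree_height (ctree T)}) \<longlonglongrightarrow> 1"
    proof (rule tendsto_sandwich[OF _ _ _ tendsto_const])
      show "(\<lambda>n. 1 - measure_pmf.prob (chain p n) ?bad) \<longlonglongrightarrow> 1"
        using tendsto_diff[OF tendsto_const[of 1] conv[OF ne, of "c / 2" K]] c by (simp add: c_def)
    qed (use lower in \<open>auto simp: measure_pmf.prob_le_1\<close>)
    then show "(\<lambda>n. measure (driving p) {w \<in> space (driving p). K \<le> tree_height (random_tree n w)}) \<longlonglongrightarrow> 1"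
      by (simp only: measure_random_tree[where P = "\<lambda>t. K \<le> tree_height t"])
  qed
qed

end
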